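(* Let $\mathbb{G}$ be a compact quantum group and let $U$ be a finite-dimensional unitary representation of $\mathbb{G}$. If $U$ and its conjugate representation $\overline{U}$ are equivalent, then the list of eigenvalues of $\rho_U$ (with multiplicities, in descending order) coincides with the list of eigenvalues of $\rho_U^{-1}$ (with multiplicities, in descending order).
   Context: A compact quantum group $\mathbb{G}$ is given by a unital C*-algebra $C(\mathbb{G})$ with a unital coassociative $*$-homomorphism $\Delta:C(\mathbb{G})\to C(\mathbb{G})\otimes C(\mathbb{G})$ satisfying the cancellation (density) conditions. A finite-dimensional representation on a nonzero finite-dimensional Hilbert space $H$ is an invertible $U\in B(H)\otimes C(\mathbb{G})$ with $(\iota\otimes\Delta)(U)=U_{12}U_{13}$; it is unitary if $U$ is unitary. $\mathrm{Mor}(U,V)$ is the space of operators $T:H_U\to H_V$ with $(T\otimes 1)U=V(T\otimes 1)$, and $\mathrm{End}(U)=\mathrm{Mor}(U,U)$; $U$ and $V$ are equivalent if $\mathrm{Mor}(U,V)$ contains an invertible operator. The contragredient of $U$ is the representation $U^{c}=(j\otimes\iota)(U^{-1})$ on the conjugate Hilbert space $\overline{H}$, where $j(T)\overline{\xi}=\overline{T^*\xi}$; $U^{cc}=(U^{c})^{c}$ is regarded as a representation on $H$ via $\overline{\overline{H}}=H$. For a finite-dimensional unitary representation $U$, $\rho_U$ denotes the unique positive invertible operator in $\mathrm{Mor}(U,U^{cc})$ such that $\mathrm{Tr}(T\rho_U)=\mathrm{Tr}(T\rho_U^{-1})$ for all $T\in\mathrm{End}(U)$. The conjugate representation is the unitary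 representation $\overline{U}=(j(\rho_U)^{1/2}\otimes 1)\,U^{c}\,(j(\rho_U)^{-1/2}\otimes 1)$ on $\overline{H}$ (it is equivalent to $U^c$). *)

theory Defs
  imports
    "HOL-Analysis.Elementary_Topology"
    "HOL-Computational_Algebra.Fundamental_Theorem_Algebra"
    "Jordan_Normal_Form.Char_Poly"
    "Jordan_Normal_Form.Schur_Decomposition"
begin

section \<open>Unital C*-algebras\<close>

text \<open>Completeness, submultiplicativity and \<open>norm 1 = 1\<close> (so the algebra is nonzero) are
  inherited from \<^class>\<open>banach\<close> and \<^class>\<open>real_normed_algebra_1\<close>.\<close>

class unital_cstar_algebra = real_normed_algebra_1 + banach +
  fixes scaleC :: "complex \<Rightarrow> 'a \<Rightarrow> 'a"  (infixr \<open>*\<^sub>C\<close> 75)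
    and star :: "'a \<Rightarrow> 'a"
  assumes scaleC_add_right: "c *\<^sub>C (x + y) = c *\<^sub>C x + c *\<^sub>C y"
    and scaleC_add_left: "(c + d) *\<^sub>C x = c *\<^sub>C x + d *\<^sub>C x"
    and scaleC_scaleC: "c *\<^sub>C d *\<^sub>C x = (c * d) *\<^sub>C x"
    and scaleC_of_real: "complex_of_real r *\<^sub>C x = r *\<^sub>R x"
    and mult_scaleC_left: "(c *\<^sub>C x) * y = c *\<^sub>C (x * y)"
    and mult_scaleC_right: "x * (c *\<^sub>C y) = c *\<^sub>C (x * y)"
    and star_add: "star (x + y) = star x + star y"
    and star_scaleC: "star (c *\<^sub>C x) = cnj c *\<^sub>C star x"
    and star_mult: "star (x * y) = star y * star x"
    and star_star: "star (star x) = x"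
    and cstar_identity: "norm (star x * x) = (norm x)\<^sup>2"

global_interpretation complex_vector: vector_space "scaleC :: complex \<Rightarrow> 'a::unital_cstar_algebra \<Rightarrow> 'a"
  using scaleC_of_real[of 1]
  by unfold_locales (simp_all add: scaleC_add_right scaleC_add_left scaleC_scaleC)

definition unital_star_hom :: "('a::unital_cstar_algebra \<Rightarrow> 'b::unital_cstar_algebra) \<Rightarrow> bool" where
  "unital_star_hom h \<longleftrightarrow>
     (\<forall>x y. h (x + y) = h x + h y) \<and> (\<forall>c x. h (c *\<^sub>C x) = c *\<^sub>C h x) \<and>
     (\<forall>x y. h (x * y) = h x * h y) \<and> (\<forall>x. h (star x) = star (h x)) \<and> h 1 = 1"

section \<open>Minimal tensor products\<close>

definition cstar_norm_on :: "'c::unital_cstar_algebra set \<Rightarrow> ('c \<Rightarrow> real) \<Rightarrow> bool" where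
  "cstar_norm_on S p \<longleftrightarrow>
     (\<forall>x\<in>S. 0 \<le> p x \<and> (p x = 0 \<longleftrightarrow> x = 0)) \<and>
     (\<forall>x\<in>S. \<forall>y\<in>S. p (x + y) \<le> p x + p y) \<and>
     (\<forall>c. \<forall>x\<in>S. p (c *\<^sub>C x) = cmod c * p x) \<and>
     (\<forall>x\<in>S. \<forall>y\<in>S. p (x * y) \<le> p x * p y) \<and>
     (\<forall>x\<in>S. p (star x * x) = (p x)\<^sup>2)"

text \<open>There is no type constructor for \<open>A \<otimes> B\<close>; instead, \<open>minimal_tensor_product t\<close> says that the
  codomain of \<open>t\<close> is a realization of the minimal tensor product with \<open>t a b\<close> in the role of
  \<open>a \<otimes> b\<close>: it contains the algebraic tensor product (\<open>tensor_injective\<close>: no relations beyond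
  bilinearity) as a dense *-subalgebra, and its norm is the least C*-norm there.\<close>

locale minimal_tensor_product =
  fixes t :: "'a::unital_cstar_algebra \<Rightarrow> 'b::unital_cstar_algebra \<Rightarrow> 'c::unital_cstar_algebra"
  assumes tensor_add_left: "t (a + a') b = t a b + t a' b"
    and tensor_add_right: "t a (b + b') = t a b + t a b'"
    and tensor_scaleC_left: "t (c *\<^sub>C a) b = c *\<^sub>C t a b"
    and tensor_scaleC_right: "t a (c *\<^sub>C b) = c *\<^sub>C t a b"
    and tensor_injective:
      "\<lbrakk>finite B; complex_vector.independent B; (\<Sum>x\<in>B. t x (f x)) = 0; x \<in> B\<rbrakk> \<Longrightarrow> f x = 0"
    and tensor_mult: "t a b * t a' b' = t (a * a') (b * b')"
    and tensor_star: "star (t a b) = t (star a) (star b)"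
    and tensor_one: "t 1 1 = 1"
    and tensor_dense: "closure (complex_vector.span {t a b | a b. True}) = UNIV"
    and tensor_norm_least:
      "\<lbrakk>cstar_norm_on (complex_vector.span {t a b | a b. True}) p;
        z \<in> complex_vector.span {t a b | a b. True}\<rbrakk> \<Longrightarrow> norm z \<le> p z"

text \<open>\<open>tensor_map t t' f g\<close> is \<open>f \<otimes> g\<close>, between the realizations given by \<open>t\<close> and \<open>t'\<close>.\<close>

definition tensor_map ::
  "('a::unital_cstar_algebra \<Rightarrow> 'b::unital_cstar_algebra \<Rightarrow> 'c::unital_cstar_algebra) \<Rightarrow>
   ('d::unital_cstar_algebra \<Rightarrow> 'e::unital_cstar_algebra \<Rightarrow> 'f::unital_cstar_algebra) \<Rightarrow>
   ('a \<Rightarrow> 'd) \<Rightarrow> ('b \<Rightarrow> 'e) \<Rightarrow> 'c \<Rightarrow> 'f" where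
  "tensor_map t t' f g = (THE h. unital_star_hom h \<and> (\<forall>a b. h (t a b) = t' (f a) (g b)))"

section \<open>Compact quantum groups\<close>

text \<open>The type \<open>'a\<close> is \<open>C(G)\<close>, \<open>'b\<close> is \<open>C(G) \<otimes> C(G)\<close>, and \<open>'c\<close> is \<open>C(G) \<otimes> C(G) \<otimes> C(G)\<close>, seen
  both as \<open>(C(G) \<otimes> C(G)) \<otimes> C(G)\<close> via \<open>tensor_l\<close> and as \<open>C(G) \<otimes> (C(G) \<otimes> C(G))\<close> via \<open>tensor_r\<close>.\<close>

locale compact_quantum_group =
  fixes tensor :: "'a::unital_cstar_algebra \<Rightarrow> 'a \<Rightarrow> 'b::unital_cstar_algebra"
    and tensor_l :: "'b \<Rightarrow> 'a \<Rightarrow> 'c::unital_cstar_algebra"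
    and tensor_r :: "'a \<Rightarrow> 'b \<Rightarrow> 'c"
    and \<Delta> :: "'a \<Rightarrow> 'b"
  assumes tensor: "minimal_tensor_product tensor"
    and tensor_l: "minimal_tensor_product tensor_l"
    and tensor_r: "minimal_tensor_product tensor_r"
    and tensor_assoc: "tensor_l (tensor x y) z = tensor_r x (tensor y z)"
    and comult_hom: "unital_star_hom \<Delta>"
    and coassociative:
      "tensor_map tensor tensor_l \<Delta> id (\<Delta> a) = tensor_map tensor tensor_r id \<Delta> (\<Delta> a)"
    and cancellation_left:
      "closure (complex_vector.span {tensor a 1 * \<Delta> b | a b. True}) = UNIV"
    and cancellation_right:
      "closure (complex_vector.span {tensor 1 a * \<Delta> b | a b. True}) = UNIV"

section \<open>Finite-dimensional representations\<close>

text \<open>By the choice of an orthonormal basis, \<open>H\<close> is \<open>\<complex>\<^sup>n\<close> with inner product \<open>v \<bullet>c w\<close> (linear in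
  \<open>v\<close>), \<open>B(H)\<close> is the algebra of complex \<open>n \<times> n\<close> matrices, and \<open>B(H) \<otimes> A\<close> is the algebra of
  \<open>n \<times> n\<close> matrices over \<open>A\<close>.\<close>

text \<open>The two-sided inverse; meaningful for invertible matrices only.\<close>

definition inv_mat :: "'a::semiring_1 mat \<Rightarrow> 'a mat" where
  "inv_mat A = (THE B. inverts_mat A B \<and> inverts_mat B A)"

definition tr :: "complex mat \<Rightarrow> complex" where
  "tr A = (\<Sum>i<dim_row A. A $$ (i, i))"

definition positive_mat :: "complex mat \<Rightarrow> bool" where
  "positive_mat A \<longleftrightarrow> square_mat A \<and> (\<forall>v \<in> carrier_vec (dim_row A). 0 \<le> (A *\<^sub>v v) \<bullet>c v)"

definition positive_sqrt :: "complex mat \<Rightarrow> complex mat" where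
  "positive_sqrt A = (THE S. positive_mat S \<and> S * S = A)"

definition star_mat :: "'a::unital_cstar_algebra mat \<Rightarrow> 'a mat" where
  "star_mat U = map_mat star (transpose_mat U)"

text \<open>\<open>T \<otimes> 1\<close>\<close>

definition amplify :: "complex mat \<Rightarrow> 'a::unital_cstar_algebra mat" where
  "amplify T = map_mat (\<lambda>c. c *\<^sub>C 1) T"

definition representation ::
  "('a::unital_cstar_algebra \<Rightarrow> 'a \<Rightarrow> 'b::unital_cstar_algebra) \<Rightarrow> ('a \<Rightarrow> 'b) \<Rightarrow> nat \<Rightarrow> 'a mat \<Rightarrow> bool"
  where
  "representation tensor \<Delta> n U \<longleftrightarrow>
     n > 0 \<and> U \<in> carrier_mat n n \<and> invertible_mat U \<and>
     map_mat \<Delta> U = map_mat (\<lambda>a. tensor a 1) U * map_mat (\<lambda>a. tensor 1 a) U"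

definition unitary_representation ::
  "('a::unital_cstar_algebra \<Rightarrow> 'a \<Rightarrow> 'b::unital_cstar_algebra) \<Rightarrow> ('a \<Rightarrow> 'b) \<Rightarrow> nat \<Rightarrow> 'a mat \<Rightarrow> bool"
  where
  "unitary_representation tensor \<Delta> n U \<longleftrightarrow>
     representation tensor \<Delta> n U \<and> inverts_mat U (star_mat U) \<and> inverts_mat (star_mat U) U"

definition Mor :: "'a::unital_cstar_algebra mat \<Rightarrow> 'a mat \<Rightarrow> complex mat set" where
  "Mor U V = {T \<in> carrier_mat (dim_row V) (dim_row U). amplify T * U = V * amplify T}"

abbreviation End :: "'a::unital_cstar_algebra mat \<Rightarrow> complex mat set" where
  "End U \<equiv> Mor U U"

definition equivalent :: "'a::unital_cstar_algebra mat \<Rightarrow> 'a mat \<Rightarrow> bool" where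
  "equivalent U V \<longleftrightarrow> (\<exists>T \<in> Mor U V. invertible_mat T)"

text \<open>The conjugate Hilbert space is \<open>\<complex>\<^sup>n\<close> as well, by means of the conjugate basis, so that
  \<open>\<xi> \<mapsto> \<xi>\<close>-bar becomes \<^const>\<open>conjugate\<close> and twice conjugating \<open>H\<close> gives \<open>H\<close> back. As
  \<open>conj_op_conjugate\<close> below shows, \<open>j\<close> is then transposition. On matrices over \<open>A\<close>, \<open>conj_op\<close> is
  \<open>j \<otimes> \<iota>\<close>.\<close>

definition conj_op :: "'a mat \<Rightarrow> 'a mat" where
  "conj_op T = transpose_mat T"

lemma conj_op_conjugate:
  fixes T :: "complex mat"
  assumes T: "T \<in> carrier_mat n n" and v: "v \<in> carrier_vec n"
  shows "conj_op T *\<^sub>v conjugate v = conjugate (mat_adjoint T *\<^sub>v v)"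
proof (rule eq_vecI)
  show "dim_vec (conj_op T *\<^sub>v conjugate v) = dim_vec (conjugate (mat_adjoint T *\<^sub>v v))"
    using T by (simp add: conj_op_def mat_adjoint_def)
next
  fix i assume "i < dim_vec (conjugate (mat_adjoint T *\<^sub>v v))"
  then have i: "i < n" using T by (simp add: mat_adjoint_def)
  have "(conj_op T *\<^sub>v conjugate v) $ i = (\<Sum>k<n. T $$ (k, i) * cnj (v $ k))"
    using T v i by (auto simp: conj_op_def scalar_prod_def atLeast0LessThan intro!: sum.cong)
  moreover have "conjugate (mat_adjoint T *\<^sub>v v) $ i = (\<Sum>k<n. T $$ (k, i) * cnj (v $ k))"
    using T v i
    by (auto simp: mat_adjoint_def scalar_prod_def atLeast0LessThan conjugate_complex_def
        cnj_sum intro!: sum.cong)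
  ultimately show "(conj_op T *\<^sub>v conjugate v) $ i = conjugate (mat_adjoint T *\<^sub>v v) $ i"
    by simp
qed

definition contragredient :: "'a::unital_cstar_algebra mat \<Rightarrow> 'a mat" where
  "contragredient U = conj_op (inv_mat U)"

text \<open>The defining property of \<open>\<rho>\<^sub>U\<close>.\<close>

definition is_rho :: "'a::unital_cstar_algebra mat \<Rightarrow> complex mat \<Rightarrow> bool" where
  "is_rho U \<rho> \<longleftrightarrow>
     \<rho> \<in> Mor U (contragredient (contragredient U)) \<and> positive_mat \<rho> \<and> invertible_mat \<rho> \<and>
     (\<forall>T \<in> End U. tr (T * \<rho>) = tr (T * inv_mat \<rho>))"

text \<open>The conjugate of \<open>U\<close>, given \<open>\<rho> = \<rho>\<^sub>U\<close>.\<close>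

definition conjugate_rep :: "complex mat \<Rightarrow> 'a::unital_cstar_algebra mat \<Rightarrow> 'a mat" where
  "conjugate_rep \<rho> U =
     amplify (positive_sqrt (conj_op \<rho>)) * contragredient U *
     amplify (inv_mat (positive_sqrt (conj_op \<rho>)))"

text \<open>For matrices with real spectrum, such as positive ones, this is the descending list of all
  eigenvalues with (algebraic) multiplicities.\<close>

definition eigenvalues_desc :: "complex mat \<Rightarrow> real list" where
  "eigenvalues_desc A = rev (sorted_list_of_multiset (image_mset Re (proots (char_poly A))))"

end

theory Submission
  imports Defs "Jordan_Normal_Form.Spectral_Radius"
begin

text \<open>Let \<open>W = F\<^sup>-\<^sup>1T\<close>, where \<open>F\<close> is the square root of \<open>j(\<rho>)\<close> that defines the conjugate
representation \<open>U'\<close> and \<open>T : U \<rightarrow> U'\<close> is an equivalence. Then \<open>W\<close> is an invertible intertwiner from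
\<open>U\<close> to \<open>U\<^sup>c\<close>. Transposition turns an intertwiner \<open>U \<rightarrow> V\<close> into one from \<open>V\<^sup>c\<close> to \<open>U\<^sup>c\<close>, so
\<open>\<rho> : U \<rightarrow> U\<^sup>c\<^sup>c\<close> gives \<open>j(\<rho>)\<^sup>-\<^sup>1 : U\<^sup>c \<rightarrow> U\<^sup>c\<^sup>c\<^sup>c\<close>, and transposing \<open>W\<close> twice lets it act as
\<open>U\<^sup>c\<^sup>c \<rightarrow> U\<^sup>c\<^sup>c\<^sup>c\<close> as well. Hence \<open>R = W\<^sup>-\<^sup>1 j(\<rho>)\<^sup>-\<^sup>1 W\<close> is another invertible intertwiner from \<open>U\<close> to
\<open>U\<^sup>c\<^sup>c\<close>, and conjugation by \<open>W\<close> followed by transposition carries the trace identity of \<open>\<rho>\<close> over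
to \<open>R\<close>. If \<open>R = \<rho>\<close>, then \<open>\<rho>\<close> is similar to the transpose of \<open>\<rho>\<^sup>-\<^sup>1\<close>, so \<open>\<rho>\<close> and \<open>\<rho>\<^sup>-\<^sup>1\<close> have the same
characteristic polynomial, which is the claim.

The equality \<open>R = \<rho>\<close> is a uniqueness statement (\<open>rho_eq_if_similar_to_positive\<close>). It is proved here
without the Haar state and without decomposing \<open>U\<close> into irreducibles; everything
happens in the algebra \<open>End(U)\<close>, which is closed under adjoints because \<open>U\<close> is unitary. Write
\<open>\<phi>(S) = Tr(S\<rho>) = Tr(S\<rho>\<^sup>-\<^sup>1)\<close> for the common value of the two traces on \<open>End(U)\<close>; it is a faithful
positive functional. Conjugation by \<open>\<rho>\<close> preserves \<open>End(U)\<close>, and it measures how far from a trace \<open>\<phi>\<close>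
is. Reading this off both expressions for \<open>\<phi>\<close> shows that conjugation by \<open>\<rho>\<^sup>2\<close> is trivial on
\<open>End(U)\<close>, and since \<open>\<rho>\<close> is positive it commutes with \<open>End(U)\<close> (\<open>rho_commutes_End\<close>). Now
\<open>X = \<rho>\<^sup>-\<^sup>1R\<close> lies in \<open>End(U)\<close>, the trace identities say \<open>\<phi>(SX) = \<phi>(SX\<^sup>-\<^sup>1)\<close> for all \<open>S\<close>, and hence
\<open>X\<^sup>2 = 1\<close>. As \<open>R = \<rho>X\<close> is similar to a positive matrix, \<open>-1\<close> is not an eigenvalue of \<open>X\<close>, and \<open>X = 1\<close>.

Apart from the faithfulness of \<open>\<phi>\<close>, positivity enters through one fact: \<open>AD + DB = 0\<close> forces \<open>D = 0\<close> when \<open>A\<close> and \<open>B\<close> are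
positive and \<open>A\<close> is invertible (\<open>positive_sylvester_unique\<close>). It also gives the uniqueness of
positive square roots, which makes \<open>F\<close> well defined; their existence comes from deflating a
positive matrix one eigenvector at a time by reflections.\<close>

section \<open>Adjoints and traces of complex matrices\<close>

lemma mat_adjoint_dim [simp]:
  "dim_row (mat_adjoint A) = dim_col A" "dim_col (mat_adjoint A) = dim_row A"
  by (auto simp: mat_adjoint_def mat_of_rows_def)

lemma mat_adjoint_carrier [simp]:
  "mat_adjoint A \<in> carrier_mat m n \<longleftrightarrow> A \<in> carrier_mat n m"
  unfolding carrier_mat_def by auto

lemma mat_adjoint_index [simp]:
  "i < dim_col A \<Longrightarrow> j < dim_row A \<Longrightarrow> mat_adjoint A $$ (i, j) = conjugate (A $$ (j, i))"
  by (simp add: mat_adjoint_def mat_of_rows_def)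

lemma mat_adjoint_mat_adjoint [simp]: "mat_adjoint (mat_adjoint A) = A"
  by (rule eq_matI) auto

lemma mat_adjoint_one [simp]: "mat_adjoint (1\<^sub>m n :: complex mat) = 1\<^sub>m n"
  by (rule eq_matI) auto

lemma mat_adjoint_mult:
  fixes A B :: "complex mat"
  assumes "A \<in> carrier_mat n m" "B \<in> carrier_mat m k"
  shows "mat_adjoint (A * B) = mat_adjoint B * mat_adjoint A"
  using assms by (intro eq_matI) (auto simp: scalar_prod_def cnj_sum mult.commute)

lemma cscalar_prod_mat_adjoint:
  fixes A :: "complex mat"
  assumes A: "A \<in> carrier_mat n m" and v: "v \<in> carrier_vec m" and w: "w \<in> carrier_vec n"
  shows "(A *\<^sub>v v) \<bullet>c w = v \<bullet>c (mat_adjoint A *\<^sub>v w)"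
proof -
  have "(A *\<^sub>v v) \<bullet>c w = (\<Sum>i<n. \<Sum>j<m. A $$ (i, j) * v $ j * cnj (w $ i))"
    using A v w by (auto simp: scalar_prod_def sum_distrib_right atLeast0LessThan)
  also have "\<dots> = (\<Sum>j<m. \<Sum>i<n. A $$ (i, j) * v $ j * cnj (w $ i))"
    by (rule sum.swap)
  also have "\<dots> = v \<bullet>c (mat_adjoint A *\<^sub>v w)"
    using A v w by (auto simp: scalar_prod_def sum_distrib_left cnj_sum atLeast0LessThan ac_simps
        intro!: sum.cong)
  finally show ?thesis .
qed

lemma tr_mult_commute:
  assumes "A \<in> carrier_mat n m" "B \<in> carrier_mat m n"
  shows "tr (A * B) = tr (B * A)"
proof -
  have "tr (A * B) = (\<Sum>i<n. \<Sum>j<m. A $$ (i, j) * B $$ (j, i))"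
    using assms by (auto simp: tr_def scalar_prod_def atLeast0LessThan intro!: sum.cong)
  also have "\<dots> = (\<Sum>j<m. \<Sum>i<n. A $$ (i, j) * B $$ (j, i))"
    by (rule sum.swap)
  also have "\<dots> = tr (B * A)"
    using assms by (auto simp: tr_def scalar_prod_def atLeast0LessThan mult.commute intro!: sum.cong)
  finally show ?thesis .
qed

lemma tr_transpose: "A \<in> carrier_mat n n \<Longrightarrow> tr (transpose_mat A) = tr A"
  by (auto simp: tr_def)

lemma tr_add:
  "A \<in> carrier_mat n n \<Longrightarrow> B \<in> carrier_mat n n \<Longrightarrow> tr (A + B) = tr A + tr B"
  by (simp add: tr_def sum.distrib)

lemma tr_minus:
  "A \<in> carrier_mat n n \<Longrightarrow> B \<in> carrier_mat n n \<Longrightarrow> tr (A - B) = tr A - tr B"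
  by (simp add: tr_def sum_subtractf)

text \<open>The squared Frobenius norm, by which vanishing of matrices is tested below.\<close>

lemma tr_gram:
  assumes "A \<in> carrier_mat n m"
  shows "tr (mat_adjoint A * A) = of_real (\<Sum>j<m. \<Sum>i<n. (cmod (A $$ (i, j)))\<^sup>2)"
  using assms
  by (auto simp: tr_def scalar_prod_def atLeast0LessThan complex_norm_square[symmetric] mult.commute simp del: of_real_power intro!: sum.cong)

lemma tr_gram_nonneg: "A \<in> carrier_mat n m \<Longrightarrow> 0 \<le> tr (mat_adjoint A * A)"
  unfolding tr_gram by (auto simp: less_eq_complex_def intro!: sum_nonneg)

lemma tr_gram_eq_0:
  assumes A: "A \<in> carrier_mat n m" and 0: "tr (mat_adjoint A * A) = 0"
  shows "A = 0\<^sub>m n m"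
proof (rule eq_matI)
  fix i j assume ij: "i < dim_row (0\<^sub>m n m)" "j < dim_col (0\<^sub>m n m)"
  have "(\<Sum>j<m. \<Sum>i<n. (cmod (A $$ (i, j)))\<^sup>2) = 0"
    using 0 unfolding tr_gram[OF A] of_real_eq_0_iff .
  then have "(cmod (A $$ (i, j)))\<^sup>2 = 0"
    using ij by (subst (asm) sum_nonneg_eq_0_iff; simp add: sum_nonneg sum_nonneg_eq_0_iff)
  then show "A $$ (i, j) = 0\<^sub>m n m $$ (i, j)" using ij by simp
qed (use A in auto)

section \<open>Two-sided inverses\<close>

lemma inv_mat_eq:
  assumes A: "A \<in> carrier_mat n n" and B: "B \<in> carrier_mat n n"
    and AB: "A * B = 1\<^sub>m n" and BA: "B * A = 1\<^sub>m n"
  shows "inv_mat A = B"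
  unfolding inv_mat_def
proof (rule the_equality)
  show "inverts_mat A B \<and> inverts_mat B A" using assms by (simp add: inverts_mat_def)
  fix C assume C: "inverts_mat A C \<and> inverts_mat C A"
  have "dim_col (A * C) = n" "dim_col (C * A) = dim_row C"
    using C A by (simp_all add: inverts_mat_def del: index_mult_mat)
  then have Cc: "C \<in> carrier_mat n n" using A by (intro carrier_matI) auto
  then have "C = (B * A) * C" using BA by simp
  also have "\<dots> = B * (A * C)" using A B Cc by simp
  also have "\<dots> = B" using C A B by (simp add: inverts_mat_def)
  finally show "C = B" .
qed

lemma invertible_matI:
  assumes "A \<in> carrier_mat n n" "B \<in> carrier_mat n n" "A * B = 1\<^sub>m n" "B * A = 1\<^sub>m n"
  shows "invertible_mat A"
  using assms by (auto simp: invertible_mat_def inverts_mat_def)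

lemma inv_mat_properties:
  assumes A: "A \<in> carrier_mat n n" and inv: "invertible_mat A"
  shows "inv_mat A \<in> carrier_mat n n" "A * inv_mat A = 1\<^sub>m n" "inv_mat A * A = 1\<^sub>m n"
proof -
  obtain B where B: "inverts_mat A B" "inverts_mat B A"
    using inv by (auto simp: invertible_mat_def)
  have "dim_col (A * B) = n" "dim_col (B * A) = dim_row B"
    using B A by (simp_all add: inverts_mat_def del: index_mult_mat)
  then have Bc: "B \<in> carrier_mat n n" using A by (intro carrier_matI) auto
  then have "inv_mat A = B" using B A by (intro inv_mat_eq) (auto simp: inverts_mat_def)
  then show "inv_mat A \<in> carrier_mat n n" "A * inv_mat A = 1\<^sub>m n" "inv_mat A * A = 1\<^sub>m n"
    using B Bc A by (auto simp: inverts_mat_def)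
qed

lemma invertible_inv_mat:
  assumes "A \<in> carrier_mat n n" "invertible_mat A"
  shows "invertible_mat (inv_mat A)"
  using inv_mat_properties[OF assms] assms(1) by (intro invertible_matI[where B = A]) auto

lemma invertible_mat_mult_left_cancel:
  fixes A :: "'a::ring_1 mat"
  assumes "A \<in> carrier_mat n n" "invertible_mat A" "X \<in> carrier_mat n m" "A * X = 0\<^sub>m n m"
  shows "X = 0\<^sub>m n m"
proof -
  note inv = inv_mat_properties[OF assms(1,2)]
  have "X = (inv_mat A * A) * X" using inv assms by simp
  also have "\<dots> = inv_mat A * (A * X)" using inv assms(1,3) by (intro assoc_mult_mat)
  also have "\<dots> = 0\<^sub>m n m" using inv assms by simp
  finally show ?thesis .
qed

lemma invertible_mat_mult:
  fixes A B :: "'a::ring_1 mat"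
  assumes A: "A \<in> carrier_mat n n" "invertible_mat A" and B: "B \<in> carrier_mat n n" "invertible_mat B"
  shows "invertible_mat (A * B)" "inv_mat (A * B) = inv_mat B * inv_mat A"
proof -
  note A' = inv_mat_properties[OF A] and B' = inv_mat_properties[OF B]
  note square_simps = assoc_mult_mat[of _ n n _ n _ n] mult_carrier_mat[of _ n n _ n]
  have "(A * B) * (inv_mat B * inv_mat A) = A * (B * inv_mat B) * inv_mat A"
    using A(1) B(1) A'(1) B'(1) by (simp add: square_simps)
  also have "\<dots> = 1\<^sub>m n" unfolding B' using A(1) A' by simp
  finally have right: "(A * B) * (inv_mat B * inv_mat A) = 1\<^sub>m n" .
  have "(inv_mat B * inv_mat A) * (A * B) = inv_mat B * (inv_mat A * A) * B"
    using A(1) B(1) A'(1) B'(1) by (simp add: square_simps)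
  also have "\<dots> = 1\<^sub>m n" unfolding A' using B(1) B' by simp
  finally have left: "(inv_mat B * inv_mat A) * (A * B) = 1\<^sub>m n" .
  show "invertible_mat (A * B)"
    by (rule invertible_matI[OF _ _ right left]) (use A(1) B(1) A'(1) B'(1) in auto)
  show "inv_mat (A * B) = inv_mat B * inv_mat A"
    by (rule inv_mat_eq[OF _ _ right left]) (use A(1) B(1) A'(1) B'(1) in auto)
qed

lemma invertible_mat_transpose:
  fixes A :: "complex mat"
  assumes A: "A \<in> carrier_mat n n" and inv: "invertible_mat A"
  shows "invertible_mat (transpose_mat A)" "inv_mat (transpose_mat A) = transpose_mat (inv_mat A)"
proof -
  note inv = inv_mat_properties[OF A inv]
  have eqs: "transpose_mat A * transpose_mat (inv_mat A) = 1\<^sub>m n"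
    "transpose_mat (inv_mat A) * transpose_mat A = 1\<^sub>m n"
    using inv A by (simp_all flip: transpose_mult[of _ n n _ n])
  show "invertible_mat (transpose_mat A)"
    using eqs A inv by (intro invertible_matI[of _ n "transpose_mat (inv_mat A)"]) auto
  show "inv_mat (transpose_mat A) = transpose_mat (inv_mat A)"
    using eqs A inv by (intro inv_mat_eq) auto
qed

section \<open>Positive matrices and their roots\<close>

text \<open>A positive matrix is only required to have a quadratic form with values in \<open>[0, \<infinity>)\<close>; polarization
recovers each pair of entries from the real values of the form at \<open>e\<^sub>i + b e\<^sub>j\<close> with
\<open>b\<close> in \<open>{0, 1, -1, \<i>, -\<i>}\<close>.\<close>

lemma positive_mat_hermitian:
  assumes A: "A \<in> carrier_mat n n" and pos: "positive_mat A"
  shows "mat_adjoint A = A"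
proof (rule eq_matI)
  fix i j assume "i < dim_row A" "j < dim_col A"
  then have i: "i < n" and j: "j < n" using A by auto
  have form: "(A *\<^sub>v (unit_vec n i + b \<cdot>\<^sub>v unit_vec n j)) \<bullet>c (unit_vec n i + b \<cdot>\<^sub>v unit_vec n j)
      = A $$ (i, i) + b * A $$ (i, j) + cnj b * A $$ (j, i) + b * cnj b * A $$ (j, j)" for b
  proof -
    have cu: "conjugate (unit_vec n k) = (unit_vec n k :: complex vec)" for k
      by (intro eq_vecI) (auto simp: unit_vec_def)
    have col: "A *\<^sub>v unit_vec n k = col A k" if "k < n" for k
      using A that by (intro eq_vecI) auto
    show ?thesis
      using A i j
      by (simp add: conjugate_add_vec[of _ n] conjugate_smult_vec cu mult_add_distrib_mat_vec[of _ n n]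
          mult_mat_vec[of _ n n] add_scalar_prod_distrib[of _ n] scalar_prod_add_distrib[of _ n]
          scalar_prod_smult_distrib[of _ n] smult_scalar_prod_distrib[of _ n]
          col algebra_simps)
  qed
  have real: "Im ((A *\<^sub>v v) \<bullet>c v) = 0" if "v \<in> carrier_vec n" for v
    using pos A that by (auto simp: positive_mat_def less_eq_complex_def)
  have "Im (A $$ (i, i) + b * A $$ (i, j) + cnj b * A $$ (j, i) + b * cnj b * A $$ (j, j)) = 0" for b
    unfolding form[symmetric] by (rule real) (use i j in simp)
  note this[of 0] this[of 1] this[of "-1"] this[of \<i>] this[of "-\<i>"]
  then have "cnj (A $$ (j, i)) = A $$ (i, j)"
    by (simp add: complex_eq_iff)
  then show "mat_adjoint A $$ (i, j) = A $$ (i, j)"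
    using A i j by simp
qed (use A in auto)

lemma positive_mat_gram:
  fixes A :: "complex mat"
  assumes A: "A \<in> carrier_mat m n"
  shows "positive_mat (mat_adjoint A * A)"
  unfolding positive_mat_def
proof (intro conjI ballI)
  fix v :: "complex vec" assume "v \<in> carrier_vec (dim_row (mat_adjoint A * A))"
  then have v: "v \<in> carrier_vec n" using A by simp
  have "((mat_adjoint A * A) *\<^sub>v v) \<bullet>c v = (A *\<^sub>v v) \<bullet>c (A *\<^sub>v v)"
    using A v cscalar_prod_mat_adjoint[of "mat_adjoint A" n m "A *\<^sub>v v" v]
    by (simp add: assoc_mult_mat_vec[of _ n m _ n])
  then show "0 \<le> ((mat_adjoint A * A) *\<^sub>v v) \<bullet>c v" by auto
qed (use A in simp)

lemma positive_mat_congruence: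
  fixes A H :: "complex mat"
  assumes A: "A \<in> carrier_mat n n" and H: "H \<in> carrier_mat n m" and pos: "positive_mat A"
  shows "positive_mat (mat_adjoint H * A * H)"
  unfolding positive_mat_def
proof (intro conjI ballI)
  fix v :: "complex vec"
  assume "v \<in> carrier_vec (dim_row (mat_adjoint H * A * H))"
  then have v: "v \<in> carrier_vec m" using H by simp
  have H': "mat_adjoint H \<in> carrier_mat m n" using H by simp
  have "(mat_adjoint H * A * H) *\<^sub>v v = mat_adjoint H *\<^sub>v (A *\<^sub>v (H *\<^sub>v v))"
    using A H H' v
    by (simp add: assoc_mult_mat_vec[of _ m n _ m] assoc_mult_mat_vec[of _ m n _ n])
  then have "((mat_adjoint H * A * H) *\<^sub>v v) \<bullet>c v = (A *\<^sub>v (H *\<^sub>v v)) \<bullet>c (H *\<^sub>v v)"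
    using cscalar_prod_mat_adjoint[OF H', of "A *\<^sub>v (H *\<^sub>v v)" v] A H v by simp
  then show "0 \<le> ((mat_adjoint H * A * H) *\<^sub>v v) \<bullet>c v"
    using pos A H v by (simp add: positive_mat_def)
qed (use H in simp)

definition householder :: "complex vec \<Rightarrow> complex mat" where
  "householder u = mat (dim_vec u) (dim_vec u)
     (\<lambda>(i, j). (if i = j then 1 else 0) - 2 / (u \<bullet>c u) * u $ i * cnj (u $ j))"

lemma householder_carrier: "u \<in> carrier_vec n \<Longrightarrow> householder u \<in> carrier_mat n n"
  by (simp add: householder_def)

lemma householder_hermitian: "mat_adjoint (householder u) = householder u"
proof -
  have "cnj (u \<bullet>c u) = u \<bullet>c u"
    by (simp add: scalar_prod_def cnj_sum mult.commute)
  then show ?thesis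
    by (intro eq_matI) (auto simp: householder_def)
qed

lemma householder_mult_vec:
  assumes "u \<in> carrier_vec n" "v \<in> carrier_vec n"
  shows "householder u *\<^sub>v v = v - (2 * (v \<bullet>c u) / (u \<bullet>c u)) \<cdot>\<^sub>v u"
proof (rule eq_vecI)
  fix i assume "i < dim_vec (v - (2 * (v \<bullet>c u) / (u \<bullet>c u)) \<cdot>\<^sub>v u)"
  then have i: "i < n" using assms by simp
  have "(householder u *\<^sub>v v) $ i
      = (\<Sum>j<n. (if i = j then v $ j else 0) - 2 / (u \<bullet>c u) * u $ i * (v $ j * cnj (u $ j)))"
    using assms i
    by (auto simp: householder_def scalar_prod_def[of "vec _ _"] atLeast0LessThan algebra_simps
        intro!: sum.cong)
  also have "\<dots> = v $ i - 2 / (u \<bullet>c u) * u $ i * (\<Sum>j<n. v $ j * cnj (u $ j))"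
    unfolding sum_subtractf sum_distrib_left[symmetric] using i by simp
  also have "\<dots> = v $ i - 2 / (u \<bullet>c u) * u $ i * (v \<bullet>c u)"
    using assms by (simp add: scalar_prod_def[of v] atLeast0LessThan)
  finally show "(householder u *\<^sub>v v) $ i = (v - (2 * (v \<bullet>c u) / (u \<bullet>c u)) \<cdot>\<^sub>v u) $ i"
    using assms i by simp
qed (use assms in \<open>simp add: householder_def\<close>)

lemma mat_eqI_mult_vec:
  fixes A B :: "complex mat"
  assumes A: "A \<in> carrier_mat m n" and B: "B \<in> carrier_mat m n"
    and eq: "\<And>v. v \<in> carrier_vec n \<Longrightarrow> A *\<^sub>v v = B *\<^sub>v v"
  shows "A = B"
proof (rule mat_col_eqI)
  fix j assume "j < dim_col B"
  then have j: "j < n" using B by simp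
  have "col C j = C *\<^sub>v unit_vec n j" if "C \<in> carrier_mat m n" for C :: "complex mat"
    using that j by (intro eq_vecI) auto
  then show "col A j = col B j"
    using A B eq[of "unit_vec n j"] by simp
qed (use A B in auto)

lemma householder_involution:
  assumes u: "u \<in> carrier_vec n" and nz: "u \<noteq> 0\<^sub>v n"
  shows "householder u * householder u = 1\<^sub>m n"
proof (rule mat_eqI_mult_vec)
  fix v :: "complex vec" assume v: "v \<in> carrier_vec n"
  define c where "c = 2 * (v \<bullet>c u) / (u \<bullet>c u)"
  have uu: "u \<bullet>c u \<noteq> 0" using u nz by simp
  have Hv: "householder u *\<^sub>v v = v - c \<cdot>\<^sub>v u"
    using householder_mult_vec[OF u v] by (simp add: c_def)
  have "(v - c \<cdot>\<^sub>v u) \<bullet>c u = v \<bullet>c u - c * (u \<bullet>c u)"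
    using u v by (simp add: minus_scalar_prod_distrib[of _ n])
  also have "\<dots> = - (v \<bullet>c u)" using uu by (simp add: c_def)
  finally have "householder u *\<^sub>v (v - c \<cdot>\<^sub>v u) = v - c \<cdot>\<^sub>v u - (- c) \<cdot>\<^sub>v u"
    using householder_mult_vec[OF u, of "v - c \<cdot>\<^sub>v u"] u v by (simp add: c_def)
  also have "\<dots> = v" using u v by (intro eq_vecI) auto
  finally show "(householder u * householder u) *\<^sub>v v = 1\<^sub>m n *\<^sub>v v"
    using v Hv householder_carrier[OF u] by (simp add: assoc_mult_mat_vec[of _ n n _ n])
qed (use householder_carrier[OF u] in auto)

text \<open>Reflecting along \<open>u = v + a e\<close>, with \<open>e\<close> the first unit vector and \<open>\<bar>a\<bar>\<close> the norm of \<open>v\<close>, sends \<open>v\<close>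
to \<open>-a e\<close>. Giving \<open>a\<close> the phase of the first entry of \<open>v\<close> avoids cancellation, so that \<open>u\<close> cannot
vanish.\<close>

lemma unitary_reflection_exists:
  fixes v :: "complex vec"
  assumes v: "v \<in> carrier_vec (Suc n)" and nz: "v \<noteq> 0\<^sub>v (Suc n)"
  obtains H c where "H \<in> carrier_mat (Suc n) (Suc n)" "mat_adjoint H = H" "H * H = 1\<^sub>m (Suc n)"
    "c \<noteq> 0" "H *\<^sub>v v = c \<cdot>\<^sub>v unit_vec (Suc n) 0"
proof -
  define s where "s = sqrt (Re (v \<bullet>c v))"
  have vv: "v \<bullet>c v = of_real (Re (v \<bullet>c v))" and vv_pos: "Re (v \<bullet>c v) > 0"
    using conjugate_square_greater_0_vec[OF v] nz by (auto simp: less_complex_def complex_eq_iff)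
  have s: "s > 0" and ss: "v \<bullet>c v = of_real s * of_real s"
    using vv_pos vv by (auto simp: s_def simp flip: of_real_mult)
  define z where "z = v $ 0"
  define a where "a = (if z = 0 then complex_of_real s else of_real s * (z / of_real (cmod z)))"
  have za: "z * cnj a = of_real s * of_real (cmod z)" and az: "a * cnj z = of_real s * of_real (cmod z)"
    using complex_norm_square[of z] by (auto simp: a_def field_simps power2_eq_square)
  have aa: "a * cnj a = of_real s * of_real s" and a0: "a \<noteq> 0"
    using complex_norm_square[of z] s by (auto simp: a_def field_simps power2_eq_square)
  define e where "e = (unit_vec (Suc n) 0 :: complex vec)"
  have e: "e \<in> carrier_vec (Suc n)" by (simp add: e_def)
  have ce: "conjugate e = e" unfolding e_def by (intro eq_vecI) (auto simp: unit_vec_def)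
  define u where "u = v + a \<cdot>\<^sub>v e"
  have u: "u \<in> carrier_vec (Suc n)" using v e by (simp add: u_def)
  have ve: "v \<bullet>c e = z" "e \<bullet>c v = cnj z" "e \<bullet>c e = 1"
    unfolding ce using v by (auto simp: z_def e_def)
  have vu: "v \<bullet>c u = of_real (s * s + s * cmod z)"
    using u v e ve ss za
    by (simp add: u_def conjugate_add_vec[of _ "Suc n"] conjugate_smult_vec scalar_prod_add_distrib[of _ "Suc n"] mult.commute)
  have eu: "a * (e \<bullet>c u) = of_real (s * s + s * cmod z)"
    using u v e ve aa az
    by (simp add: u_def conjugate_add_vec[of _ "Suc n"] conjugate_smult_vec scalar_prod_add_distrib[of _ "Suc n"] algebra_simps)
  have uu: "u \<bullet>c u = v \<bullet>c u + a * (e \<bullet>c u)"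
    using u v e by (subst (1) u_def) (simp add: add_scalar_prod_distrib[of _ "Suc n"])
  have pos: "s * s + s * cmod z > 0" using s by (simp add: add_pos_nonneg)
  then have uu0: "u \<bullet>c u \<noteq> 0" "2 * (v \<bullet>c u) / (u \<bullet>c u) = 1"
    unfolding uu vu eu by (simp_all del: of_real_add of_real_mult add: mult_2[symmetric])
  have "householder u *\<^sub>v v = v - 1 \<cdot>\<^sub>v u"
    using householder_mult_vec[OF u v] uu0(2) by simp
  also have "\<dots> = (- a) \<cdot>\<^sub>v e" using v e by (intro eq_vecI) (auto simp: u_def)
  finally show thesis
    using that[of "householder u" "- a"] a0 uu0(1) householder_carrier[OF u] householder_hermitian[of u]
      householder_involution[OF u] u by (auto simp: e_def)
qed

text \<open>A reflection moves an eigenvector to the first coordinate axis. Since the reflected matrix is again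
hermitian, it splits into the eigenvalue and a smaller positive block, to which induction applies.
A hermitian fourth root, rather than a square root, is constructed because its sign does not have
to be controlled: its square is hermitian and automatically positive.\<close>

lemma positive_mat_fourth_root:
  assumes "A \<in> carrier_mat n n" and "positive_mat A"
  obtains R where "R \<in> carrier_mat n n" "mat_adjoint R = R" "(R * R) * (R * R) = A"
  using assms
proof (induction n arbitrary: A thesis)
  case 0
  then show ?case by (intro 0(1)[of "0\<^sub>m 0 0"]) auto
next
  case (Suc n)
  let ?n = "Suc n"
  note A = Suc.prems(2) and pos = Suc.prems(3)
  obtain l where "l \<in> spectrum A" using spectrum_non_empty[OF A] by auto
  then obtain v where v: "v \<in> carrier_vec ?n" "v \<noteq> 0\<^sub>v ?n" and Av: "A *\<^sub>v v = l \<cdot>\<^sub>v v"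
    using A by (auto simp: spectrum_def eigenvalue_def eigenvector_def)
  obtain H c where H: "H \<in> carrier_mat ?n ?n" "mat_adjoint H = H" "H * H = 1\<^sub>m ?n"
    and c: "c \<noteq> 0" and Hv: "H *\<^sub>v v = c \<cdot>\<^sub>v unit_vec ?n 0"
    by (rule unitary_reflection_exists[OF v])
  define e where "e = (unit_vec ?n 0 :: complex vec)"
  have e: "e \<in> carrier_vec ?n" by (simp add: e_def)
  define B where "B = H * A * H"
  have B: "B \<in> carrier_mat ?n ?n" using A H by (simp add: B_def)
  have posB: "positive_mat B"
    using positive_mat_congruence[OF A H(1) pos] H(2) by (simp add: B_def)
  have hermB: "mat_adjoint B = B" by (rule positive_mat_hermitian[OF B posB])
  have "v = H *\<^sub>v (H *\<^sub>v v)"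
    using H v by (simp add: assoc_mult_mat_vec[of _ ?n ?n _ ?n, symmetric])
  also have "\<dots> = c \<cdot>\<^sub>v (H *\<^sub>v e)"
    unfolding Hv e_def using H by (simp add: mult_mat_vec[of _ ?n ?n])
  finally have He: "H *\<^sub>v e = (1 / c) \<cdot>\<^sub>v v"
    using c by (metis divide_self_if times_divide_eq_left mult_1 one_smult_vec smult_smult_assoc)
  have "B *\<^sub>v e = H *\<^sub>v (A *\<^sub>v (H *\<^sub>v e))"
    using A H e by (simp add: B_def assoc_mult_mat_vec[of _ ?n ?n _ ?n])
  also have "\<dots> = (l / c) \<cdot>\<^sub>v (H *\<^sub>v v)"
    unfolding He using A H v Av
    by (simp add: mult_mat_vec[of _ ?n ?n] smult_smult_assoc)
  also have "\<dots> = l \<cdot>\<^sub>v e"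
    unfolding Hv using c by (simp add: e_def smult_smult_assoc)
  finally have Be: "B *\<^sub>v e = l \<cdot>\<^sub>v e" .
  have col0: "B $$ (i, 0) = (if i = 0 then l else 0)" if "i < ?n" for i
    using arg_cong[OF Be, of "\<lambda>x. x $ i"] B that by (simp add: e_def)
  have row0: "B $$ (0, i) = 0" if "i < ?n" "i \<noteq> 0" for i
    using arg_cong[OF hermB, of "\<lambda>M. M $$ (0, i)"] col0[of i] B that by simp
  have "conjugate e = e" unfolding e_def by (intro eq_vecI) (auto simp: unit_vec_def)
  then have "(B *\<^sub>v e) \<bullet>c e = l" unfolding Be by (simp add: e_def)
  then have l: "0 \<le> l" using posB B e by (auto simp: positive_mat_def)
  \<comment> \<open>Compression by the inclusion of the last \<open>n\<close> coordinates cuts out the lower right block.\<close>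
  define J where "J = mat ?n n (\<lambda>(i, j). if i = Suc j then 1 else 0 :: complex)"
  define A' where "A' = mat_adjoint J * B * J"
  have J: "J \<in> carrier_mat ?n n" by (simp add: J_def)
  have A': "A' \<in> carrier_mat n n" using J B by (simp add: A'_def)
  have posA': "positive_mat A'"
    unfolding A'_def by (rule positive_mat_congruence[OF B J posB])
  have A'_index: "A' $$ (i, j) = B $$ (Suc i, Suc j)" if "i < n" "j < n" for i j
  proof -
    have BJ: "(mat_adjoint J * B) $$ (i, k) = B $$ (Suc i, k)" if k: "k < ?n" for k
    proof -
      have "(mat_adjoint J * B) $$ (i, k) = (\<Sum>m\<in>{0..<?n}. cnj (J $$ (m, i)) * B $$ (m, k))"
        using \<open>i < n\<close> k B J by (simp add: scalar_prod_def del: sum.op_ivl_Suc)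
      also have "\<dots> = (\<Sum>m\<in>{0..<?n}. if m = Suc i then B $$ (m, k) else 0)"
        using \<open>i < n\<close> by (intro sum.cong) (auto simp: J_def)
      finally show ?thesis using \<open>i < n\<close> by (simp add: sum.delta del: sum.op_ivl_Suc)
    qed
    have KJ: "(K * J) $$ (i, j) = (\<Sum>m\<in>{0..<?n}. K $$ (i, m) * J $$ (m, j))"
      if "K \<in> carrier_mat n ?n" for K
      using that \<open>i < n\<close> \<open>j < n\<close> J by (simp add: scalar_prod_def del: sum.op_ivl_Suc)
    have "A' $$ (i, j) = (\<Sum>m\<in>{0..<?n}. (mat_adjoint J * B) $$ (i, m) * J $$ (m, j))"
      unfolding A'_def by (rule KJ) (use J B in simp)
    also have "\<dots> = (\<Sum>m\<in>{0..<?n}. if m = Suc j then B $$ (Suc i, m) else 0)"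
      using that BJ by (intro sum.cong) (auto simp: J_def)
    finally show ?thesis using that by (simp add: sum.delta del: sum.op_ivl_Suc)
  qed
  define blk where "blk = (\<lambda>x. four_block_mat (mat 1 1 (\<lambda>_. x :: complex)) (0\<^sub>m 1 n) (0\<^sub>m n 1))"
  have blk_carrier: "blk x M \<in> carrier_mat ?n ?n" if "M \<in> carrier_mat n n" for x M
    using that by (intro carrier_matI) (simp_all add: blk_def)
  have blk_mult: "blk x M * blk y N = blk (x * y) (M * N)"
    if "M \<in> carrier_mat n n" "N \<in> carrier_mat n n" for x y M N
    unfolding blk_def using that
    by (subst mult_four_block_mat[of _ 1 1 _ n _ n _ _ 1 _ n])
      (auto simp: scalar_prod_def intro!: arg_cong[where f = "\<lambda>X. four_block_mat X _ _ _"])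
  have B_blk: "B = blk l A'"
  proof (rule eq_matI)
    fix i j assume "i < dim_row (blk l A')" "j < dim_col (blk l A')"
    then have "i < ?n" "j < ?n" using blk_carrier[OF A', of l] by simp_all
    then show "B $$ (i, j) = blk l A' $$ (i, j)"
      using A' col0[of i] row0[of j] A'_index[of "i - 1" "j - 1"] by (auto simp: blk_def)
  qed (use B blk_carrier[OF A', of l] in auto)
  obtain R' where R': "R' \<in> carrier_mat n n" "mat_adjoint R' = R'" "(R' * R') * (R' * R') = A'"
    using Suc.IH[OF _ A' posA'] by blast
  define r where "r = complex_of_real (sqrt (sqrt (Re l)))"
  have r: "(r * r) * (r * r) = l"
    using l by (simp add: r_def less_eq_complex_def complex_eq_iff mult.assoc flip: of_real_mult)
  define R0 where "R0 = blk r R'"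
  have R0: "R0 \<in> carrier_mat ?n ?n" using blk_carrier R' by (simp add: R0_def)
  have R0_root: "(R0 * R0) * (R0 * R0) = B"
    using R' by (simp add: R0_def blk_mult r B_blk del: assoc_mult_mat)
  have R0_herm: "mat_adjoint R0 = R0"
  proof (rule eq_matI)
    fix i j assume "i < dim_row R0" "j < dim_col R0"
    then have ij: "i < ?n" "j < ?n" using R0 by auto
    have R'ij: "cnj (R' $$ (j - 1, i - 1)) = R' $$ (i - 1, j - 1)" if "0 < i" "0 < j"
    proof -
      have "i - 1 < n" "j - 1 < n" using ij that by linarith+
      then show ?thesis using mat_adjoint_index[of "i - 1" R' "j - 1"] R'(1,2) by simp
    qed
    then show "mat_adjoint R0 $$ (i, j) = R0 $$ (i, j)"
      using R' R0 ij by (auto simp: R0_def blk_def r_def)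
  qed (use R0 in auto)
  define R where "R = H * R0 * H"
  have R: "R \<in> carrier_mat ?n ?n" using H R0 by (simp add: R_def)
  have cancel: "(H * X * H) * (H * Y * H) = H * (X * Y) * H"
    if X: "X \<in> carrier_mat ?n ?n" and Y: "Y \<in> carrier_mat ?n ?n" for X Y
  proof -
    have "(H * X * H) * (H * Y * H) = H * X * (H * H) * Y * H"
      using H(1) X Y by (simp add: assoc_mult_mat[of _ ?n ?n _ ?n _ ?n] mult_carrier_mat[of _ ?n ?n _ ?n])
    then show ?thesis
      using H X Y by (simp add: assoc_mult_mat[of _ ?n ?n _ ?n _ ?n] mult_carrier_mat[of _ ?n ?n _ ?n])
  qed
  have R_root: "(R * R) * (R * R) = A"
  proof -
    have R00: "R0 * R0 \<in> carrier_mat ?n ?n" using R0 by simp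
    have "(R * R) * (R * R) = H * B * H"
      unfolding R_def cancel[OF R0 R0] cancel[OF R00 R00] R0_root ..
    also have "\<dots> = (H * H) * A * (H * H)"
      unfolding B_def using H(1) A
      by (simp add: assoc_mult_mat[of _ ?n ?n _ ?n _ ?n] mult_carrier_mat[of _ ?n ?n _ ?n])
    also have "\<dots> = A" using H(3) A by simp
    finally show ?thesis .
  qed
  have R_herm: "mat_adjoint R = R"
    unfolding R_def using H R0 R0_herm
    by (simp add: mat_adjoint_mult[of _ ?n ?n _ ?n] assoc_mult_mat[of _ ?n ?n _ ?n _ ?n] mult_carrier_mat[of _ ?n ?n _ ?n])
  show ?case by (rule Suc.prems(1)[OF R R_herm R_root])
qed

text \<open>If \<open>A = T\<^sup>*T\<close> with \<open>T\<close> hermitian, then the transpose of \<open>A\<close> is the Gram matrix of the transpose of \<open>T\<close>.\<close>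

lemma positive_mat_transpose:
  fixes A :: "complex mat"
  assumes A: "A \<in> carrier_mat n n" and pos: "positive_mat A"
  shows "positive_mat (transpose_mat A)"
proof -
  obtain R where R: "R \<in> carrier_mat n n" "mat_adjoint R = R" "(R * R) * (R * R) = A"
    by (rule positive_mat_fourth_root[OF A pos])
  define T where "T = transpose_mat (R * R)"
  have T: "T \<in> carrier_mat n n" using R by (simp add: T_def)
  have "mat_adjoint (R * R) = R * R" using R by (simp add: mat_adjoint_mult[of _ n n _ n])
  moreover have "mat_adjoint T = transpose_mat (mat_adjoint (R * R))"
    using R by (intro eq_matI) (auto simp: T_def simp del: index_mult_mat(1))
  ultimately have "mat_adjoint T * T = transpose_mat ((R * R) * (R * R))"
    using R by (subst transpose_mult[of "R * R" n n "R * R" n]) (auto simp: T_def)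
  then show ?thesis using positive_mat_gram[OF T] R(3) by simp
qed

lemma positive_mat_inv:
  fixes A :: "complex mat"
  assumes A: "A \<in> carrier_mat n n" and pos: "positive_mat A" and inv: "invertible_mat A"
  shows "positive_mat (inv_mat A)"
proof -
  note A' = inv_mat_properties[OF A inv]
  have herm: "mat_adjoint A = A" by (rule positive_mat_hermitian[OF A pos])
  have "inv_mat A = mat_adjoint (inv_mat A)"
  proof (rule inv_mat_eq[OF A])
    show "mat_adjoint (inv_mat A) \<in> carrier_mat n n" using A' by simp
    show "A * mat_adjoint (inv_mat A) = 1\<^sub>m n"
      using mat_adjoint_mult[OF A'(1) A] A'(3) herm by simp
    show "mat_adjoint (inv_mat A) * A = 1\<^sub>m n"
      using mat_adjoint_mult[OF A A'(1)] A'(2) herm by simp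
  qed
  then have "mat_adjoint (inv_mat A) * A * inv_mat A = inv_mat A"
    using A A' by simp
  then show ?thesis using positive_mat_congruence[OF A A'(1) pos] by simp
qed

section \<open>Faithfulness of the trace against positive matrices\<close>

text \<open>Writing \<open>A = TT\<close> with \<open>T\<close> hermitian turns the weighted trace into the squared Frobenius norm of \<open>ZT\<close>.\<close>

lemma positive_weighted_trace_faithful:
  fixes Z A :: "complex mat"
  assumes A: "A \<in> carrier_mat n n" "positive_mat A" "invertible_mat A"
    and Z: "Z \<in> carrier_mat n n" and 0: "tr (mat_adjoint Z * Z * A) = 0"
  shows "Z = 0\<^sub>m n n"
proof -
  note square_simps = assoc_mult_mat[of _ n n _ n _ n] mult_carrier_mat[of _ n n _ n]
  obtain R where R: "R \<in> carrier_mat n n" "mat_adjoint R = R" "(R * R) * (R * R) = A"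
    by (rule positive_mat_fourth_root[OF A(1,2)])
  define T where "T = R * R"
  have T: "T \<in> carrier_mat n n" "mat_adjoint T = T" "T * T = A"
    using R by (simp_all add: T_def mat_adjoint_mult[of _ n n _ n] square_simps)
  have Z': "mat_adjoint Z \<in> carrier_mat n n" using Z by simp
  have "tr (mat_adjoint (Z * T) * (Z * T)) = tr (T * (mat_adjoint Z * Z * T))"
    using T Z Z' by (simp add: mat_adjoint_mult[of _ n n _ n] square_simps)
  also have "\<dots> = tr ((mat_adjoint Z * Z * T) * T)"
    using T Z Z' by (intro tr_mult_commute[of _ n n]) (auto simp: square_simps)
  also have "\<dots> = tr (mat_adjoint Z * Z * A)"
    unfolding T(3)[symmetric] using T(1) Z Z' by (simp add: square_simps)
  finally have "Z * T = 0\<^sub>m n n" using 0 Z T by (intro tr_gram_eq_0) auto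
  then have "Z * T * T = 0\<^sub>m n n" using T by simp
  then have "Z * A = 0\<^sub>m n n" unfolding T(3)[symmetric] using Z T by (simp add: square_simps)
  moreover have "Z = Z * A * inv_mat A"
    using Z A inv_mat_properties[OF A(1,3)] by (simp add: square_simps)
  ultimately show ?thesis using inv_mat_properties[OF A(1,3)] by simp
qed

text \<open>Multiplying by \<open>D\<^sup>*\<close> and taking traces gives \<open>Tr(D\<^sup>*AD) + Tr(D\<^sup>*DB) = 0\<close>. With hermitian square roots
\<open>S\<close> of \<open>A\<close> and \<open>T\<close> of \<open>B\<close>, the summands are the squared Frobenius norms of \<open>SD\<close> and \<open>DT\<close>, so both
vanish.\<close>

lemma positive_sylvester_unique:
  fixes A B D :: "complex mat"
  assumes A: "A \<in> carrier_mat n n" "positive_mat A" "invertible_mat A"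
    and B: "B \<in> carrier_mat n n" "positive_mat B"
    and D: "D \<in> carrier_mat n n" and eq: "A * D + D * B = 0\<^sub>m n n"
  shows "D = 0\<^sub>m n n"
proof -
  note square_simps = assoc_mult_mat[of _ n n _ n _ n] mult_carrier_mat[of _ n n _ n]
  obtain Q where Q: "Q \<in> carrier_mat n n" "mat_adjoint Q = Q" "(Q * Q) * (Q * Q) = A"
    by (rule positive_mat_fourth_root[OF A(1,2)])
  obtain P where P: "P \<in> carrier_mat n n" "mat_adjoint P = P" "(P * P) * (P * P) = B"
    by (rule positive_mat_fourth_root[OF B])
  define S where "S = Q * Q"
  define T where "T = P * P"
  have S: "S \<in> carrier_mat n n" "mat_adjoint S = S" "S * S = A"
    using Q by (simp_all add: S_def mat_adjoint_mult[of _ n n _ n] square_simps)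
  have T: "T \<in> carrier_mat n n" "mat_adjoint T = T" "T * T = B"
    using P by (simp_all add: T_def mat_adjoint_mult[of _ n n _ n] square_simps)
  have D': "mat_adjoint D \<in> carrier_mat n n" using D by simp
  have "tr (mat_adjoint (S * D) * (S * D)) = tr (mat_adjoint D * (A * D))"
    using S D D' unfolding S(3)[symmetric] by (simp add: mat_adjoint_mult[of _ n n _ n] square_simps)
  moreover have "tr (mat_adjoint (D * T) * (D * T)) = tr (mat_adjoint D * (D * B))"
  proof -
    have "tr (mat_adjoint (D * T) * (D * T)) = tr (T * (mat_adjoint D * (D * T)))"
      using T D D' by (simp add: mat_adjoint_mult[of _ n n _ n] square_simps)
    also have "\<dots> = tr ((mat_adjoint D * (D * T)) * T)"
      using T D D' by (intro tr_mult_commute[of _ n n]) (auto simp: square_simps)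
    finally show ?thesis
      unfolding T(3)[symmetric] using T D D' by (simp add: square_simps)
  qed
  moreover have "tr (mat_adjoint D * (A * D)) + tr (mat_adjoint D * (D * B)) = 0"
  proof -
    have "tr (mat_adjoint D * (A * D)) + tr (mat_adjoint D * (D * B))
        = tr (mat_adjoint D * (A * D) + mat_adjoint D * (D * B))"
      using A B D D' by (intro tr_add[of _ n, symmetric]) (auto simp: square_simps)
    also have "\<dots> = tr (mat_adjoint D * (A * D + D * B))"
      using A B D D' by (subst mult_add_distrib_mat[of _ n n _ n]) (auto simp: square_simps)
    finally show ?thesis unfolding eq using D' by (simp add: tr_def)
  qed
  ultimately have "tr (mat_adjoint (S * D) * (S * D)) = 0"
    using tr_gram_nonneg[of "S * D" n n] tr_gram_nonneg[of "D * T" n n] S T D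
    by (metis add_nonneg_eq_0_iff mult_carrier_mat)
  then have "S * D = 0\<^sub>m n n" using S D by (intro tr_gram_eq_0) auto
  then have "A * D = 0\<^sub>m n n" using S D unfolding S(3)[symmetric] by (simp add: square_simps)
  then show ?thesis using A D by (intro invertible_mat_mult_left_cancel[of A n D n])
qed

text \<open>For two positive roots \<open>S\<close> and \<open>T\<close> of \<open>A\<close>, the difference satisfies \<open>S(S - T) + (S - T)T = 0\<close>, which
makes the square root unique and so gives the description by \<open>THE\<close> a value.\<close>

lemma positive_sqrt_properties:
  assumes A: "A \<in> carrier_mat n n" and pos: "positive_mat A" and inv: "invertible_mat A"
  shows "positive_sqrt A \<in> carrier_mat n n" "invertible_mat (positive_sqrt A)"
proof -
  note square_simps = assoc_mult_mat[of _ n n _ n _ n] mult_carrier_mat[of _ n n _ n]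
  have root: "S \<in> carrier_mat n n \<and> invertible_mat S" if S: "positive_mat S" "S * S = A" for S
  proof -
    have "dim_row S = n" "dim_col S = n"
      using S A by (auto simp: positive_mat_def)
    then have Sc: "S \<in> carrier_mat n n" by auto
    note A' = inv_mat_properties[OF A inv]
    have right: "S * (S * inv_mat A) = 1\<^sub>m n" using Sc A' S by (simp add: assoc_mult_mat[of S n n S n _ n, symmetric])
    then have "(S * inv_mat A) * S = 1\<^sub>m n"
      using Sc A' by (intro mat_mult_left_right_inverse[of S]) auto
    with right Sc A' show ?thesis
      by (auto intro!: invertible_matI[of S n "S * inv_mat A"])
  qed
  obtain R where R: "R \<in> carrier_mat n n" "mat_adjoint R = R" "(R * R) * (R * R) = A"
    by (rule positive_mat_fourth_root[OF A pos])
  have posRR: "positive_mat (R * R)" using positive_mat_gram[OF R(1)] R(2) by simp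
  have "positive_sqrt A = R * R"
    unfolding positive_sqrt_def
  proof (rule the_equality)
    show "positive_mat (R * R) \<and> (R * R) * (R * R) = A" using posRR R by simp
    fix S assume S: "positive_mat S \<and> S * S = A"
    define T where "T = R * R"
    have T: "T \<in> carrier_mat n n" "invertible_mat T" "positive_mat T" "T * T = A"
      using root[of T] posRR R by (auto simp: T_def)
    have S': "S \<in> carrier_mat n n" "invertible_mat S" using root[of S] S by auto
    have "S * (S - T) + (S - T) * T = (S * S - S * T) + (S * T - T * T)"
      using S' T by (simp add: mult_minus_distrib_mat[of _ n n _ n] minus_mult_distrib_mat[of _ n n])
    also have "\<dots> = 0\<^sub>m n n" using S S' T by (intro eq_matI) auto
    finally have "S - T = 0\<^sub>m n n"
      using S S' T by (intro positive_sylvester_unique[of S n T "S - T"]) auto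
    then show "S = R * R"
      using S' T unfolding T_def[symmetric]
      by (intro eq_matI) (auto dest: arg_cong[where f = "\<lambda>M. M $$ (_, _)"] simp: mat_eq_iff)
  qed
  with root[of "R * R"] posRR R show "positive_sqrt A \<in> carrier_mat n n" "invertible_mat (positive_sqrt A)"
    by auto
qed

section \<open>Calculus of intertwiners\<close>

lemma scaleC_one_commute: "(c *\<^sub>C 1) * x = x * (c *\<^sub>C (1::'a::unital_cstar_algebra))"
  by (simp add: mult_scaleC_left mult_scaleC_right)

lemma amplify_carrier [simp]: "amplify T \<in> carrier_mat m n \<longleftrightarrow> T \<in> carrier_mat m n"
  by (simp add: amplify_def)

lemma amplify_dim [simp]: "dim_row (amplify T) = dim_row T" "dim_col (amplify T) = dim_col T"
  by (simp_all add: amplify_def)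

lemma amplify_one [simp]: "amplify (1\<^sub>m n) = (1\<^sub>m n :: 'a::unital_cstar_algebra mat)"
  by (intro eq_matI) (auto simp: amplify_def)

lemma amplify_mult:
  assumes "S \<in> carrier_mat n m" "T \<in> carrier_mat m k"
  shows "(amplify (S * T) :: 'a::unital_cstar_algebra mat) = amplify S * amplify T"
  using assms
  by (intro eq_matI)
    (auto simp: amplify_def scalar_prod_def complex_vector.scale_sum_left mult_scaleC_left scaleC_scaleC)

text \<open>Transposition does not reverse products of matrices over a noncommutative algebra. It does so here
because the entries of one factor are scalars.\<close>

lemma transpose_amplify_mult:
  fixes U :: "'a::unital_cstar_algebra mat"
  assumes "T \<in> carrier_mat n m" "U \<in> carrier_mat m k"
  shows "transpose_mat (amplify T * U) = transpose_mat U * amplify (transpose_mat T)"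
  using assms
  by (intro eq_matI) (auto simp: amplify_def scalar_prod_def scaleC_one_commute)

lemma transpose_mult_amplify:
  fixes U :: "'a::unital_cstar_algebra mat"
  assumes "U \<in> carrier_mat n m" "T \<in> carrier_mat m k"
  shows "transpose_mat (U * amplify T) = amplify (transpose_mat T) * transpose_mat U"
  using assms
  by (intro eq_matI) (auto simp: amplify_def scalar_prod_def scaleC_one_commute)

lemma star_sum: "star (\<Sum>i\<in>I. f i) = (\<Sum>i\<in>I. star (f i :: 'a::unital_cstar_algebra))"
proof -
  have "star (0::'a) = 0" using star_add[of 0 "0::'a"] by simp
  then show ?thesis by (induction I rule: infinite_finite_induct) (simp_all add: star_add)
qed

lemma star_one: "star (1::'a::unital_cstar_algebra) = 1"
  using star_mult[of "star 1" "1::'a"] by (simp add: star_star)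

lemma star_mat_dim [simp]: "dim_row (star_mat A) = dim_col A" "dim_col (star_mat A) = dim_row A"
  by (simp_all add: star_mat_def)

lemma star_mat_carrier [simp]: "star_mat A \<in> carrier_mat m n \<longleftrightarrow> A \<in> carrier_mat n m"
  by (simp add: star_mat_def)

lemma star_mat_mult:
  fixes A B :: "'a::unital_cstar_algebra mat"
  assumes "A \<in> carrier_mat n m" "B \<in> carrier_mat m k"
  shows "star_mat (A * B) = star_mat B * star_mat A"
  using assms by (intro eq_matI) (auto simp: star_mat_def scalar_prod_def star_sum star_mult)

lemma star_mat_amplify:
  "star_mat (amplify T :: 'a::unital_cstar_algebra mat) = amplify (mat_adjoint T)"
  by (intro eq_matI) (auto simp: star_mat_def amplify_def star_scaleC star_one)

lemma contragredient_carrier: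
  "U \<in> carrier_mat n n \<Longrightarrow> invertible_mat U \<Longrightarrow> contragredient U \<in> carrier_mat n n"
  by (simp add: contragredient_def conj_op_def inv_mat_properties)

lemma MorI:
  "T \<in> carrier_mat n n \<Longrightarrow> U \<in> carrier_mat n n \<Longrightarrow> V \<in> carrier_mat n n
    \<Longrightarrow> amplify T * U = V * amplify T \<Longrightarrow> T \<in> Mor U V"
  by (simp add: Mor_def)

lemma MorD:
  assumes "T \<in> Mor U V" "U \<in> carrier_mat n n" "V \<in> carrier_mat n n"
  shows "T \<in> carrier_mat n n" "amplify T * U = V * amplify T"
  using assms by (auto simp: Mor_def)

lemma Mor_mult:
  fixes U V W :: "'a::unital_cstar_algebra mat"
  assumes S: "S \<in> Mor V W" and T: "T \<in> Mor U V"
    and U: "U \<in> carrier_mat n n" and V: "V \<in> carrier_mat n n" and W: "W \<in> carrier_mat n n"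
  shows "S * T \<in> Mor U W"
proof (rule MorI[OF _ U W])
  note S = MorD[OF S V W] and T = MorD[OF T U V]
  show "S * T \<in> carrier_mat n n" using S T by simp
  have "amplify (S * T) * U = amplify S * (amplify T * U)"
    using S T U by (simp add: amplify_mult[of _ n n] assoc_mult_mat[of _ n n _ n _ n])
  also have "\<dots> = amplify S * V * amplify T"
    unfolding T(2) using S(1) T(1) V by (simp add: assoc_mult_mat[of _ n n _ n _ n])
  also have "\<dots> = W * amplify (S * T)"
    unfolding S(2) using S T W by (simp add: amplify_mult[of _ n n] assoc_mult_mat[of _ n n _ n _ n])
  finally show "amplify (S * T) * U = W * amplify (S * T)" .
qed

lemma amplify_inverse:
  fixes T :: "complex mat"
  assumes "T \<in> carrier_mat n n" "invertible_mat T"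
  shows "amplify T * amplify (inv_mat T) = (1\<^sub>m n :: 'a::unital_cstar_algebra mat)"
    "amplify (inv_mat T) * amplify T = (1\<^sub>m n :: 'a mat)"
  using inv_mat_properties[OF assms] assms(1) by (simp_all flip: amplify_mult[of _ n n _ n])

lemma Mor_inv:
  fixes U V :: "'a::unital_cstar_algebra mat"
  assumes T: "T \<in> Mor U V" and inv: "invertible_mat T"
    and U: "U \<in> carrier_mat n n" and V: "V \<in> carrier_mat n n"
  shows "inv_mat T \<in> Mor V U"
proof (rule MorI[OF _ V U])
  note T = MorD[OF T U V]
  note T' = inv_mat_properties[OF T(1) inv] and aT = amplify_inverse[OF T(1) inv, where ?'a = 'a]
  note square_simps = assoc_mult_mat[of _ n n _ n _ n] mult_carrier_mat[of _ n n _ n]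
  show "inv_mat T \<in> carrier_mat n n" by (rule T')
  have "amplify (inv_mat T) * V = amplify (inv_mat T) * (V * amplify T) * amplify (inv_mat T)"
    using T(1) T' V aT by (simp add: square_simps)
  also have "\<dots> = (amplify (inv_mat T) * amplify T) * U * amplify (inv_mat T)"
    unfolding T(2)[symmetric] using T(1) T' U by (simp add: square_simps)
  also have "\<dots> = U * amplify (inv_mat T)" using aT U by simp
  finally show "amplify (inv_mat T) * V = U * amplify (inv_mat T)" .
qed

text \<open>This is how the contragredient is seen to be invertible: over a noncommutative algebra the transpose
of an invertible matrix need not be invertible, but a matrix conjugate to an invertible one is.\<close>

lemma Mor_invertible:
  fixes U V :: "'a::unital_cstar_algebra mat"
  assumes T: "T \<in> Mor U V" "invertible_mat T" and U: "U \<in> carrier_mat n n" "invertible_mat U"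
    and V: "V \<in> carrier_mat n n"
  shows "invertible_mat V"
proof -
  note T1 = MorD[OF T(1) U(1) V]
  note aT = amplify_inverse[OF T1(1) T(2), where ?'a = 'a]
  note T' = inv_mat_properties[OF T1(1) T(2)] and U' = inv_mat_properties[OF U]
  note square_simps = assoc_mult_mat[of _ n n _ n _ n] mult_carrier_mat[of _ n n _ n]
  let ?V' = "amplify T * inv_mat U * amplify (inv_mat T)"
  have V_eq: "V = amplify T * U * amplify (inv_mat T)"
    unfolding T1(2) using T1(1) T' V aT by (simp add: square_simps)
  have "V * ?V' = amplify T * U * (amplify (inv_mat T) * amplify T) * inv_mat U * amplify (inv_mat T)"
    unfolding V_eq using T1(1) T' U U' by (simp add: square_simps)
  also have "\<dots> = amplify T * (U * inv_mat U) * amplify (inv_mat T)"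
    unfolding aT using T1(1) T'(1) U(1) U'(1) by (simp add: square_simps)
  also have "\<dots> = 1\<^sub>m n" unfolding U' using aT T1(1) by simp
  finally have right: "V * ?V' = 1\<^sub>m n" .
  have "?V' * V = amplify T * inv_mat U * (amplify (inv_mat T) * amplify T) * U * amplify (inv_mat T)"
    unfolding V_eq using T1(1) T' U U' by (simp add: square_simps)
  also have "\<dots> = amplify T * (inv_mat U * U) * amplify (inv_mat T)"
    unfolding aT using T1(1) T'(1) U(1) U'(1) by (simp add: square_simps)
  also have "\<dots> = 1\<^sub>m n" unfolding U' using aT T1(1) by simp
  finally have left: "?V' * V = 1\<^sub>m n" .
  show ?thesis
    using V right left T1(1) T' U' by (intro invertible_matI[of V n ?V']) simp_all
qed

lemma Mor_transpose:
  fixes U V :: "'a::unital_cstar_algebra mat"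
  assumes T: "T \<in> Mor U V"
    and U: "U \<in> carrier_mat n n" "invertible_mat U" and V: "V \<in> carrier_mat n n" "invertible_mat V"
  shows "transpose_mat T \<in> Mor (contragredient V) (contragredient U)"
proof (rule MorI)
  note T = MorD[OF T U(1) V(1)]
  note U' = inv_mat_properties[OF U] and V' = inv_mat_properties[OF V]
  note square_simps = assoc_mult_mat[of _ n n _ n _ n] mult_carrier_mat[of _ n n _ n]
  show "transpose_mat T \<in> carrier_mat n n" using T by simp
  show "contragredient V \<in> carrier_mat n n" "contragredient U \<in> carrier_mat n n"
    using U V by (simp_all add: contragredient_carrier)
  have "inv_mat V * amplify T = inv_mat V * (amplify T * U) * inv_mat U"
    using T(1) U V' U' by (simp add: square_simps)
  also have "\<dots> = (inv_mat V * V) * amplify T * inv_mat U"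
    unfolding T(2) using T(1) V V'(1) U'(1) by (simp add: square_simps)
  also have "\<dots> = amplify T * inv_mat U" unfolding V' using T(1) by simp
  finally have "transpose_mat (inv_mat V * amplify T) = transpose_mat (amplify T * inv_mat U)"
    by simp
  then show "amplify (transpose_mat T) * contragredient V = contragredient U * amplify (transpose_mat T)"
    using T(1) U' V'
    by (simp add: contragredient_def conj_op_def transpose_mult_amplify[of _ n n]
        transpose_amplify_mult[of _ n n])
qed

text \<open>Taking adjoints in \<open>TU = UT\<close> gives \<open>U\<^sup>*T\<^sup>* = T\<^sup>*U\<^sup>*\<close>, and conjugating by the unitary \<open>U\<close> replaces
\<open>U\<^sup>*\<close> by \<open>U\<close>.\<close>

lemma End_mat_adjoint:
  fixes U :: "'a::unital_cstar_algebra mat"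
  assumes U: "U \<in> carrier_mat n n" "U * star_mat U = 1\<^sub>m n" "star_mat U * U = 1\<^sub>m n"
    and T: "T \<in> End U"
  shows "mat_adjoint T \<in> End U"
proof (rule MorI[OF _ U(1,1)])
  note T = MorD[OF T U(1,1)]
  note square_simps = assoc_mult_mat[of _ n n _ n _ n] mult_carrier_mat[of _ n n _ n]
  show "mat_adjoint T \<in> carrier_mat n n" using T by simp
  have *: "star_mat U * amplify (mat_adjoint T) = amplify (mat_adjoint T) * star_mat U"
    using arg_cong[OF T(2), of star_mat] T(1) U(1)
    by (simp add: star_mat_mult[of _ n n] star_mat_amplify)
  have "amplify (mat_adjoint T) * U = U * (star_mat U * amplify (mat_adjoint T)) * U"
    using T(1) U by (simp add: assoc_mult_mat[of U n n "star_mat U" n _ n, symmetric] del: assoc_mult_mat)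
  also have "\<dots> = U * amplify (mat_adjoint T) * (star_mat U * U)"
    unfolding * using T(1) U(1) by (simp add: square_simps)
  also have "\<dots> = U * amplify (mat_adjoint T)" unfolding U(3) using T(1) U(1) by simp
  finally show "amplify (mat_adjoint T) * U = U * amplify (mat_adjoint T)" .
qed

lemma Mor_minus:
  fixes U V :: "'a::unital_cstar_algebra mat"
  assumes S: "S \<in> Mor U V" and T: "T \<in> Mor U V"
    and U: "U \<in> carrier_mat n n" and V: "V \<in> carrier_mat n n"
  shows "S - T \<in> Mor U V"
proof (rule MorI[OF _ U V])
  note S = MorD[OF S U V] and T = MorD[OF T U V]
  show "S - T \<in> carrier_mat n n" using T by (intro minus_carrier_mat) simp
  have "(amplify (S - T) :: 'a mat) = amplify S - amplify T"
    using S T by (intro eq_matI) (auto simp: amplify_def complex_vector.scale_left_diff_distrib)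
  then show "amplify (S - T) * U = V * amplify (S - T)"
    using S T U V by (simp add: minus_mult_distrib_mat[of _ n n] mult_minus_distrib_mat[of _ n n])
qed

section \<open>The modular operator of a unitary representation\<close>

text \<open>Invertibility of the contragredient is listed separately, since it does not follow from that of
\<open>U\<close> by matrix algebra alone and \<open>U\<^sup>c\<^sup>c\<close> has no meaning without it.\<close>

locale unitary_with_modulus =
  fixes n :: nat and U :: "'a::unital_cstar_algebra mat" and \<rho> :: "complex mat"
  assumes U: "U \<in> carrier_mat n n"
    and U_star: "U * star_mat U = 1\<^sub>m n" "star_mat U * U = 1\<^sub>m n"
    and contragredient_invertible: "invertible_mat (contragredient U)"
    and rho: "is_rho U \<rho>"
begin

abbreviation "\<rho>' \<equiv> inv_mat \<rho>"

lemma U_invertible: "invertible_mat U"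
  using U U_star by (intro invertible_matI[of U n "star_mat U"]) auto

lemma Uc_carrier: "contragredient U \<in> carrier_mat n n"
  using U U_invertible by (rule contragredient_carrier)

lemma Ucc_carrier: "contragredient (contragredient U) \<in> carrier_mat n n"
  using Uc_carrier contragredient_invertible by (rule contragredient_carrier)

lemma rho_Mor: "\<rho> \<in> Mor U (contragredient (contragredient U))"
  and rho_positive: "positive_mat \<rho>"
  and rho_invertible: "invertible_mat \<rho>"
  and rho_tr: "\<And>T. T \<in> End U \<Longrightarrow> tr (T * \<rho>) = tr (T * \<rho>')"
  using rho by (auto simp: is_rho_def)

lemma rho_carrier: "\<rho> \<in> carrier_mat n n"
  using MorD(1)[OF rho_Mor U Ucc_carrier] .

lemmas rho_inv = inv_mat_properties[OF rho_carrier rho_invertible]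

text \<open>With all dimensions fixed to \<open>n\<close>, the simplifier can discharge the carrier premises of
associativity.\<close>

lemmas square_simps = assoc_mult_mat[of _ n n _ n _ n] mult_carrier_mat[of _ n n _ n]

lemma Ucc_invertible: "invertible_mat (contragredient (contragredient U))"
  by (rule Mor_invertible[OF rho_Mor rho_invertible U U_invertible Ucc_carrier])

lemma End_carrier: "T \<in> End U \<Longrightarrow> T \<in> carrier_mat n n"
  using MorD(1)[OF _ U U] .

lemma End_contragredient_twice:
  assumes "T \<in> End U"
  shows "T \<in> End (contragredient (contragredient U))"
  using Mor_transpose[OF Mor_transpose[OF assms U U_invertible U U_invertible]
      Uc_carrier contragredient_invertible Uc_carrier contragredient_invertible]
  by simp

text \<open>The modular automorphism of \<open>End(U)\<close>: the intertwiner \<open>\<rho>\<close> identifies \<open>U\<close> with \<open>U\<^sup>c\<^sup>c\<close>, and every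
endomorphism of \<open>U\<close> is one of \<open>U\<^sup>c\<^sup>c\<close>.\<close>

lemma rho_conj_End:
  assumes "T \<in> End U"
  shows "\<rho>' * T * \<rho> \<in> End U"
  using Mor_mult[OF Mor_mult[OF Mor_inv[OF rho_Mor rho_invertible U Ucc_carrier]
        End_contragredient_twice[OF assms] Ucc_carrier Ucc_carrier U] rho_Mor U Ucc_carrier U] .

lemma End_trace_zero:
  assumes Z: "Z \<in> End U" and 0: "\<And>S. S \<in> End U \<Longrightarrow> tr (S * Z * \<rho>) = 0"
  shows "Z = 0\<^sub>m n n"
  using positive_weighted_trace_faithful[OF rho_carrier rho_positive rho_invertible End_carrier[OF Z]]
    0[OF End_mat_adjoint[OF U U_star Z]] by simp

text \<open>The two functionals \<open>Tr(\<cdot> \<rho>)\<close> and \<open>Tr(\<cdot> \<rho>\<^sup>-\<^sup>1)\<close> fail to be traces in opposite directions: exchanging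
two factors costs a conjugation by \<open>\<rho>\<close> of the factor that ends up on the left in the first case, and
of the one that ends up on the right in the second.\<close>

lemma tr_rho_conj_left:
  assumes S: "S \<in> carrier_mat n n" and T: "T \<in> carrier_mat n n"
  shows "tr ((\<rho>' * T * \<rho>) * S * \<rho>) = tr (S * T * \<rho>)"
proof -
  have "tr ((\<rho>' * T * \<rho>) * S * \<rho>) = tr ((\<rho>' * T * \<rho>) * (S * \<rho>))"
    using S T rho_carrier rho_inv(1) by (simp add: square_simps)
  also have "\<dots> = tr ((S * \<rho>) * (\<rho>' * T * \<rho>))"
    using S T rho_carrier rho_inv(1) by (intro tr_mult_commute[of _ n n]) (auto simp: square_simps)
  also have "\<dots> = tr (S * (\<rho> * \<rho>') * T * \<rho>)"
    using S T rho_carrier rho_inv(1) by (simp add: square_simps)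
  also have "\<dots> = tr (S * T * \<rho>)"
    unfolding rho_inv using S by simp
  finally show ?thesis .
qed

lemma tr_rho_conj_right:
  assumes S: "S \<in> carrier_mat n n" and T: "T \<in> carrier_mat n n"
  shows "tr (S * (\<rho>' * T * \<rho>) * \<rho>') = tr (T * S * \<rho>')"
proof -
  have "tr (S * (\<rho>' * T * \<rho>) * \<rho>') = tr ((S * \<rho>') * T * (\<rho> * \<rho>'))"
    using S T rho_carrier rho_inv(1) by (simp add: square_simps)
  also have "\<dots> = tr ((S * \<rho>') * T)"
    unfolding rho_inv using S T rho_inv(1) by simp
  also have "\<dots> = tr (T * (S * \<rho>'))"
    using S T rho_inv(1) by (intro tr_mult_commute[of _ n n]) auto
  finally show ?thesis using S T rho_inv(1) by (simp add: square_simps)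
qed

text \<open>Let \<open>\<beta>(T) = \<rho>\<^sup>-\<^sup>1T\<rho>\<close> and let \<open>\<phi>\<close> be the common value of the two trace functionals on \<open>End(U)\<close>. Then
\<open>\<phi>(\<beta>\<^sup>2(T)S) = \<phi>(S\<beta>(T)) = \<phi>(TS)\<close>, where the first equation uses \<open>\<phi>(S) = Tr(S\<rho>)\<close> and the second
\<open>\<phi>(S) = Tr(S\<rho>\<^sup>-\<^sup>1)\<close>. By faithfulness \<open>\<beta>\<^sup>2(T) = T\<close>, that is, \<open>\<rho>\<^sup>2T = T\<rho>\<^sup>2\<close>. The commutator
\<open>D = \<rho>T - T\<rho>\<close> then satisfies \<open>\<rho>D + D\<rho> = 0\<close>, so it vanishes.\<close>

lemma rho_commutes_End:
  assumes T: "T \<in> End U"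
  shows "\<rho> * T = T * \<rho>"
proof -
  note r = rho_carrier and i = rho_inv(1)
  define T1 where "T1 = \<rho>' * T * \<rho>"
  define T2 where "T2 = \<rho>' * T1 * \<rho>"
  have T1: "T1 \<in> End U" unfolding T1_def by (rule rho_conj_End[OF T])
  have T2: "T2 \<in> End U" unfolding T2_def by (rule rho_conj_End[OF T1])
  note c = End_carrier[OF T] End_carrier[OF T1] End_carrier[OF T2]
  define Z where "Z = T2 - T"
  have Z: "Z \<in> End U" unfolding Z_def by (rule Mor_minus[OF T2 T U U])
  have Z': "mat_adjoint Z \<in> End U" by (rule End_mat_adjoint[OF U U_star Z])
  have tr_eq: "tr (T2 * S * \<rho>) = tr (T * S * \<rho>)" if S: "S \<in> End U" for S
  proof -
    have "tr (T2 * S * \<rho>) = tr (S * T1 * \<rho>)"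
      unfolding T2_def by (rule tr_rho_conj_left[OF End_carrier[OF S] c(2)])
    also have "\<dots> = tr (S * T1 * \<rho>')"
      by (rule rho_tr[OF Mor_mult[OF S T1 U U U]])
    also have "\<dots> = tr (T * S * \<rho>')"
      unfolding T1_def by (rule tr_rho_conj_right[OF End_carrier[OF S] c(1)])
    also have "\<dots> = tr (T * S * \<rho>)"
      by (rule rho_tr[OF Mor_mult[OF T S U U U], symmetric])
    finally show ?thesis .
  qed
  have "tr (Z * mat_adjoint Z * \<rho>) = tr (T2 * mat_adjoint Z * \<rho>) - tr (T * mat_adjoint Z * \<rho>)"
    using c r End_carrier[OF Z'] unfolding Z_def
    by (simp add: minus_mult_distrib_mat[of _ n n _ _ n] square_simps tr_minus[of _ n] del: mat_adjoint_carrier)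
  then have "tr (Z * mat_adjoint Z * \<rho>) = 0"
    using tr_eq[OF Z'] by simp
  then have "mat_adjoint Z = 0\<^sub>m n n"
    using positive_weighted_trace_faithful[OF r rho_positive rho_invertible End_carrier[OF Z']] by simp
  then have "mat_adjoint (mat_adjoint Z) = mat_adjoint (0\<^sub>m n n)" by simp
  then have Z0: "Z = 0\<^sub>m n n" by (simp add: mat_eq_iff)
  have T2_T: "T2 = T"
  proof (rule eq_matI)
    fix a b assume "a < dim_row T" "b < dim_col T"
    then show "T2 $$ (a, b) = T $$ (a, b)"
      using arg_cong[OF Z0, of "\<lambda>M. M $$ (a, b)"] c by (simp add: Z_def)
  qed (use c in auto)
  have "\<rho> * \<rho> * T2 = \<rho> * (\<rho> * \<rho>') * (\<rho>' * T * \<rho>) * \<rho>"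
    unfolding T2_def T1_def using c(1) r i by (simp add: square_simps)
  also have "\<dots> = \<rho> * (\<rho>' * T * \<rho>) * \<rho>" unfolding rho_inv using r by simp
  also have "\<dots> = (\<rho> * \<rho>') * T * \<rho> * \<rho>"
    using c(1) r i by (simp add: square_simps)
  also have "\<dots> = T * \<rho> * \<rho>" unfolding rho_inv using c(1) by simp
  finally have sq: "\<rho> * \<rho> * T = T * \<rho> * \<rho>" unfolding T2_T .
  have "\<rho> * (\<rho> * T - T * \<rho>) + (\<rho> * T - T * \<rho>) * \<rho>
      = (\<rho> * \<rho> * T - \<rho> * T * \<rho>) + (\<rho> * T * \<rho> - T * \<rho> * \<rho>)"
    using c(1) r
    by (simp add: minus_mult_distrib_mat[of _ n n _ _ n] mult_minus_distrib_mat[of _ n n _ n] square_simps)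
  also have "\<dots> = 0\<^sub>m n n"
    unfolding sq using c(1) r by (intro eq_matI) (auto simp del: index_mult_mat(1))
  finally have D0: "\<rho> * T - T * \<rho> = 0\<^sub>m n n"
    by (rule positive_sylvester_unique[OF r rho_positive rho_invertible r rho_positive, rotated])
      (use c(1) r in \<open>intro minus_carrier_mat mult_carrier_mat\<close>)
  show ?thesis
  proof (rule eq_matI)
    fix a b assume "a < dim_row (T * \<rho>)" "b < dim_col (T * \<rho>)"
    then show "(\<rho> * T) $$ (a, b) = (T * \<rho>) $$ (a, b)"
      using arg_cong[OF D0, of "\<lambda>M. M $$ (a, b)"] c r by (simp del: index_mult_mat(1))
  qed (use c r in auto)
qed

text \<open>The quotient \<open>X = \<rho>\<^sup>-\<^sup>1R\<close> is an endomorphism of \<open>U\<close> and so commutes with \<open>\<rho>\<close>. Comparing the trace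
identities for \<open>R\<close> and \<open>\<rho>\<close> gives \<open>X = X\<^sup>-\<^sup>1\<close>. For \<open>Y = X - 1\<close> this means \<open>XY = -Y\<close>, hence
\<open>RY = -Y\<rho>\<close>, and \<open>W\<close> turns this into \<open>Q(WY) + (WY)\<rho> = 0\<close> with \<open>Q\<close> and \<open>\<rho>\<close> positive.\<close>

lemma rho_eq_if_similar_to_positive:
  assumes R: "R \<in> Mor U (contragredient (contragredient U))" "invertible_mat R"
    and tr_R: "\<And>S. S \<in> End U \<Longrightarrow> tr (S * R) = tr (S * inv_mat R)"
    and W: "W \<in> carrier_mat n n" "invertible_mat W"
    and Q: "Q \<in> carrier_mat n n" "positive_mat Q" "invertible_mat Q"
    and sim: "W * R = Q * W"
  shows "R = \<rho>"
proof -
  note r = rho_carrier and i = rho_inv(1)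
  have Rc: "R \<in> carrier_mat n n" by (rule MorD(1)[OF R(1) U Ucc_carrier])
  note R' = inv_mat_properties[OF Rc R(2)]
  define X where "X = \<rho>' * R"
  define X' where "X' = inv_mat R * \<rho>"
  have X: "X \<in> End U"
    unfolding X_def by (rule Mor_mult[OF Mor_inv[OF rho_Mor rho_invertible U Ucc_carrier] R(1) U Ucc_carrier U])
  have X': "X' \<in> End U"
    unfolding X'_def by (rule Mor_mult[OF Mor_inv[OF R U Ucc_carrier] rho_Mor U Ucc_carrier U])
  note c = End_carrier[OF X] End_carrier[OF X']
  have "X * X' = \<rho>' * (R * inv_mat R) * \<rho>"
    unfolding X_def X'_def using r i Rc R'(1) by (simp add: square_simps)
  also have "\<dots> = 1\<^sub>m n" unfolding R' using rho_inv r by simp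
  finally have XX': "X * X' = 1\<^sub>m n" .
  have "\<rho> * X = (\<rho> * \<rho>') * R" unfolding X_def using r i Rc by (simp add: square_simps)
  then have rX: "\<rho> * X = R" unfolding rho_inv using Rc by simp
  then have Xr: "X * \<rho> = R" using rho_commutes_End[OF X] by simp
  have "X' * \<rho>' = inv_mat R * (\<rho> * \<rho>')" unfolding X'_def using r i R'(1) by (simp add: square_simps)
  then have X'r: "X' * \<rho>' = inv_mat R" unfolding rho_inv using R' by simp
  have "X - X' = 0\<^sub>m n n"
  proof (rule End_trace_zero)
    show "X - X' \<in> End U" by (rule Mor_minus[OF X X' U U])
    fix S assume S: "S \<in> End U"
    have Sc: "S \<in> carrier_mat n n" by (rule End_carrier[OF S])
    have "tr (S * X * \<rho>) = tr (S * (X * \<rho>))" using Sc c r by (simp add: square_simps)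
    also have "\<dots> = tr (S * inv_mat R)" unfolding Xr by (rule tr_R[OF S])
    also have "\<dots> = tr (S * (X' * \<rho>'))" unfolding X'r ..
    also have "\<dots> = tr (S * X' * \<rho>')" using Sc c i by (simp add: square_simps)
    also have "\<dots> = tr (S * X' * \<rho>)"
      by (rule rho_tr[OF Mor_mult[OF S X' U U U], symmetric])
    finally have "tr (S * X * \<rho>) = tr (S * X' * \<rho>)" .
    then show "tr (S * (X - X') * \<rho>) = 0"
      using Sc c r
      by (simp add: mult_minus_distrib_mat[of _ n n _ n] minus_mult_distrib_mat[of _ n n _ _ n] tr_minus[of _ n] square_simps)
  qed
  then have "X = X'"
    using c by (auto simp: mat_eq_iff)
  then have XX: "X * X = 1\<^sub>m n" using XX' by simp
  define Y where "Y = X - 1\<^sub>m n"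
  have Y: "Y \<in> carrier_mat n n" unfolding Y_def by (intro minus_carrier_mat) simp
  have RY: "R * Y = - (Y * \<rho>)"
  proof -
    have "R * Y = \<rho> * X * X - \<rho> * X"
      unfolding Y_def rX using Rc c by (simp add: mult_minus_distrib_mat[of _ n n _ n])
    also have "\<rho> * X * X = \<rho> * (X * X)" using r c by (simp add: square_simps)
    also have "\<rho> * (X * X) - \<rho> * X = - (X * \<rho> - \<rho>)"
      unfolding XX rX Xr using r Rc by (intro eq_matI) auto
    also have "X * \<rho> - \<rho> = Y * \<rho>"
      unfolding Y_def using r c by (simp add: minus_mult_distrib_mat[of _ n n _ _ n])
    finally show ?thesis .
  qed
  have "Q * (W * Y) = W * (R * Y)"
    unfolding assoc_mult_mat[OF Q(1) W(1) Y, symmetric] sim[symmetric] by (rule assoc_mult_mat[OF W(1) Rc Y])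
  moreover have "(W * Y) * \<rho> = W * (Y * \<rho>)" by (rule assoc_mult_mat[OF W(1) Y r])
  ultimately have "Q * (W * Y) + (W * Y) * \<rho> = W * (R * Y) + W * (Y * \<rho>)" by simp
  also have "\<dots> = 0\<^sub>m n n"
    unfolding RY using W Y r by (intro eq_matI) (auto simp: mult_carrier_mat[of _ n n])
  finally have "W * Y = 0\<^sub>m n n"
    by (rule positive_sylvester_unique[OF Q rho_carrier rho_positive, rotated]) (use W Y in simp)
  then have "Y = 0\<^sub>m n n" by (rule invertible_mat_mult_left_cancel[OF W Y])
  then have "X = 1\<^sub>m n" unfolding Y_def using c by (auto simp: mat_eq_iff)
  then show ?thesis using rX r by simp
qed

text \<open>The trace identity on \<open>End(U\<^sup>c\<^sup>c)\<close> follows from the one on \<open>End(U)\<close>, because conjugation by \<open>\<rho>\<close>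
carries the former to the latter and leaves both traces unchanged.\<close>

lemma End_contragredient_twice_tr:
  assumes S: "S \<in> End (contragredient (contragredient U))"
  shows "tr (S * \<rho>) = tr (S * \<rho>')"
proof -
  note r = rho_carrier and i = rho_inv(1)
  have Sc: "S \<in> carrier_mat n n" using MorD(1)[OF S Ucc_carrier Ucc_carrier] .
  have "\<rho>' * S * \<rho> \<in> End U"
    using Mor_mult[OF Mor_mult[OF Mor_inv[OF rho_Mor rho_invertible U Ucc_carrier] S Ucc_carrier Ucc_carrier U] rho_Mor U Ucc_carrier U] .
  then have "tr (\<rho>' * S * \<rho> * \<rho>) = tr (\<rho>' * S * \<rho> * \<rho>')" by (rule rho_tr)
  moreover have "tr (\<rho>' * S * \<rho> * \<rho>) = tr (S * \<rho>)"
  proof -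
    have "tr (\<rho>' * S * \<rho> * \<rho>) = tr (\<rho>' * (S * \<rho> * \<rho>))"
      using Sc r i by (simp add: square_simps)
    also have "\<dots> = tr ((S * \<rho> * \<rho>) * \<rho>')"
      using Sc r i by (intro tr_mult_commute[of _ n n]) (auto simp: square_simps)
    also have "\<dots> = tr (S * \<rho> * (\<rho> * \<rho>'))"
      using Sc r i by (simp add: square_simps)
    finally show ?thesis unfolding rho_inv using Sc r by simp
  qed
  moreover have "tr (\<rho>' * S * \<rho> * \<rho>') = tr (S * \<rho>')"
  proof -
    have "tr (\<rho>' * S * \<rho> * \<rho>') = tr (\<rho>' * S * (\<rho> * \<rho>'))"
      using Sc r i by (simp add: square_simps)
    also have "\<dots> = tr (\<rho>' * S)" unfolding rho_inv using Sc i by simp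
    also have "\<dots> = tr (S * \<rho>')"
      using Sc i by (intro tr_mult_commute[of _ n n]) auto
    finally show ?thesis .
  qed
  ultimately show ?thesis by simp
qed

text \<open>The matrix on the left is the composite of \<open>W : U \<rightarrow> U\<^sup>c\<close>, of \<open>j(\<rho>)\<^sup>-\<^sup>1 : U\<^sup>c \<rightarrow> U\<^sup>c\<^sup>c\<^sup>c\<close> and of \<open>W\<^sup>-\<^sup>1\<close>
from \<open>U\<^sup>c\<^sup>c\<^sup>c\<close> to \<open>U\<^sup>c\<^sup>c\<close>, where \<open>W : U\<^sup>c\<^sup>c \<rightarrow> U\<^sup>c\<^sup>c\<^sup>c\<close> is obtained by transposing twice. It has the
trace identity of \<open>\<rho>\<close>: for \<open>S\<close> in \<open>End(U)\<close>, cyclicity and transposition move \<open>Tr(SR)\<close> and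
\<open>Tr(SR\<^sup>-\<^sup>1)\<close> to \<open>Tr(S\<^sub>1\<rho>\<^sup>-\<^sup>1)\<close> and \<open>Tr(S\<^sub>1\<rho>)\<close>, where \<open>S\<^sub>1\<close> is the transpose of \<open>WSW\<^sup>-\<^sup>1\<close> and
lies in \<open>End(U\<^sup>c\<^sup>c)\<close>.\<close>

lemma rho_eq_if_equivalent_contragredient:
  assumes W: "W \<in> Mor U (contragredient U)" "invertible_mat W"
  shows "inv_mat W * inv_mat (transpose_mat \<rho>) * W = \<rho>"
proof -
  note r = rho_carrier and i = rho_inv(1)
  let ?C = "contragredient U"
  let ?P = "transpose_mat \<rho>"
  have Wc: "W \<in> carrier_mat n n" by (rule MorD(1)[OF W(1) U Uc_carrier])
  note W' = inv_mat_properties[OF Wc W(2)]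
  have P: "?P \<in> carrier_mat n n" "invertible_mat ?P" "positive_mat ?P"
    using r invertible_mat_transpose(1)[OF r rho_invertible] positive_mat_transpose[OF r rho_positive]
    by simp_all
  define Q where "Q = inv_mat ?P"
  have Q: "Q \<in> carrier_mat n n" "positive_mat Q" "invertible_mat Q" "inv_mat Q = ?P"
    using inv_mat_properties[OF P(1,2)] P
    by (auto simp: Q_def intro: positive_mat_inv invertible_inv_mat inv_mat_eq[of _ n])
  have Q_transpose: "Q = transpose_mat \<rho>'"
    unfolding Q_def by (rule invertible_mat_transpose(2)[OF r rho_invertible])
  have Uccc_carrier: "contragredient (contragredient ?C) \<in> carrier_mat n n"
    using Ucc_carrier Ucc_invertible by (rule contragredient_carrier)
  have WT: "transpose_mat W \<in> Mor (contragredient ?C) ?C"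
    by (rule Mor_transpose[OF W(1) U U_invertible Uc_carrier contragredient_invertible])
  have W_cc: "W \<in> Mor (contragredient ?C) (contragredient (contragredient ?C))"
    using Mor_transpose[OF WT Ucc_carrier Ucc_invertible Uc_carrier contragredient_invertible] by simp
  have "?P \<in> Mor (contragredient (contragredient ?C)) ?C"
    by (rule Mor_transpose[OF rho_Mor U U_invertible Ucc_carrier Ucc_invertible])
  then have Q_Mor: "Q \<in> Mor ?C (contragredient (contragredient ?C))"
    unfolding Q_def by (rule Mor_inv[OF _ P(2) Uccc_carrier Uc_carrier])
  define R where "R = inv_mat W * (Q * W)"
  have QW: "Q * W \<in> carrier_mat n n" "invertible_mat (Q * W)" "inv_mat (Q * W) = inv_mat W * ?P"
    using Q Wc invertible_mat_mult[OF Q(1,3) Wc W(2)] by simp_all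
  have R_Mor: "R \<in> Mor U (contragredient ?C)"
    unfolding R_def
    by (rule Mor_mult[OF Mor_inv[OF W_cc W(2) Ucc_carrier Uccc_carrier] Mor_mult[OF Q_Mor W(1) U Uc_carrier Uccc_carrier] U Uccc_carrier Ucc_carrier])
  have W'inv: "invertible_mat (inv_mat W)" "inv_mat (inv_mat W) = W"
    using invertible_inv_mat[OF Wc W(2)] inv_mat_eq[OF W'(1) Wc W'(3,2)] by simp_all
  have R_inv: "invertible_mat R" "inv_mat R = inv_mat W * ?P * W"
    unfolding R_def using invertible_mat_mult[OF W'(1) W'inv(1) QW(1,2)] by (simp_all add: QW(3) W'inv(2))
  have "R = \<rho>"
  proof (rule rho_eq_if_similar_to_positive[OF R_Mor R_inv(1) _ Wc W(2) Q(1-3)])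
    show "W * R = Q * W"
    proof -
      have "W * R = (W * inv_mat W) * (Q * W)"
        unfolding R_def using Wc W'(1) QW(1) by (intro assoc_mult_mat[symmetric])
      then show ?thesis unfolding W' left_mult_one_mat[OF QW(1)] .
    qed
    fix S assume S: "S \<in> End U"
    have Sc: "S \<in> carrier_mat n n" by (rule End_carrier[OF S])
    define S1 where "S1 = transpose_mat (W * S * inv_mat W)"
    have "W * S * inv_mat W \<in> End ?C"
      using Mor_mult[OF Mor_mult[OF W(1) S U U Uc_carrier] Mor_inv[OF W U Uc_carrier] Uc_carrier U Uc_carrier] .
    then have S1: "S1 \<in> End (contragredient ?C)"
      unfolding S1_def by (rule Mor_transpose[OF _ Uc_carrier contragredient_invertible Uc_carrier contragredient_invertible])
    have S1c: "S1 \<in> carrier_mat n n" by (rule MorD(1)[OF S1 Ucc_carrier Ucc_carrier])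
    have move: "tr (S * (inv_mat W * transpose_mat M * W)) = tr (S1 * M)" if M: "M \<in> carrier_mat n n" for M
    proof -
      have "tr (S * (inv_mat W * transpose_mat M * W)) = tr ((S * inv_mat W * transpose_mat M) * W)"
        using Sc Wc W'(1) M by (simp add: square_simps)
      also have "\<dots> = tr (W * (S * inv_mat W * transpose_mat M))"
        using Sc Wc W'(1) M by (intro tr_mult_commute[of _ n n]) (auto simp: square_simps)
      also have "\<dots> = tr ((W * S * inv_mat W) * transpose_mat M)"
        using Sc Wc W'(1) M by (simp add: square_simps)
      also have "\<dots> = tr (transpose_mat (M * S1))"
        unfolding transpose_mult[OF M S1c] by (simp add: S1_def)
      also have "\<dots> = tr (M * S1)" using M S1c by (intro tr_transpose[of _ n]) simp
      also have "\<dots> = tr (S1 * M)" by (rule tr_mult_commute[OF M S1c])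
      finally show ?thesis .
    qed
    have "tr (S * R) = tr (S1 * \<rho>')"
      using move[OF i] Wc W'(1) Q(1) by (simp add: R_def Q_transpose[symmetric] square_simps)
    also have "\<dots> = tr (S1 * \<rho>)" by (rule End_contragredient_twice_tr[OF S1, symmetric])
    also have "\<dots> = tr (S * inv_mat R)" unfolding R_inv(2) by (rule move[OF r, symmetric])
    finally show "tr (S * R) = tr (S * inv_mat R)" .
  qed
  then show ?thesis unfolding R_def Q_def[symmetric] using Wc W'(1) Q(1) by (simp add: square_simps)
qed

end

theorem proposition3p1:
  fixes tensor :: "'a::unital_cstar_algebra \<Rightarrow> 'a \<Rightarrow> 'b::unital_cstar_algebra"
    and tensor_l :: "'b \<Rightarrow> 'a \<Rightarrow> 'c::unital_cstar_algebra"
    and tensor_r :: "'a \<Rightarrow> 'b \<Rightarrow> 'c"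
    and \<Delta> :: "'a \<Rightarrow> 'b"
    and n :: nat and U :: "'a mat" and \<rho> :: "complex mat"
  assumes G: "compact_quantum_group tensor tensor_l tensor_r \<Delta>"
    and U: "unitary_representation tensor \<Delta> n U"
    and rho: "is_rho U \<rho>"
    and self_conjugate: "equivalent U (conjugate_rep \<rho> U)"
  shows "eigenvalues_desc \<rho> = eigenvalues_desc (inv_mat \<rho>)"
proof -
  have U_carrier: "U \<in> carrier_mat n n" and Uinv: "invertible_mat U"
    and star: "U * star_mat U = 1\<^sub>m n" "star_mat U * U = 1\<^sub>m n"
    using U by (auto simp: unitary_representation_def representation_def inverts_mat_def)
  have r: "\<rho> \<in> carrier_mat n n" "positive_mat \<rho>" "invertible_mat \<rho>"
    using rho U_carrier by (auto simp: is_rho_def positive_mat_def Mor_def)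
  let ?C = "contragredient U"
  have C: "?C \<in> carrier_mat n n" using U_carrier Uinv by (rule contragredient_carrier)
  define F where "F = positive_sqrt (conj_op \<rho>)"
  have F: "F \<in> carrier_mat n n" "invertible_mat F"
    using positive_sqrt_properties[of "transpose_mat \<rho>" n] r(1) positive_mat_transpose[OF r(1,2)]
      invertible_mat_transpose(1)[OF r(1,3)]
    by (simp_all add: F_def conj_op_def)
  note F' = inv_mat_properties[OF F]
  have conj: "conjugate_rep \<rho> U = amplify F * ?C * amplify (inv_mat F)"
    by (simp add: conjugate_rep_def F_def)
  have V: "conjugate_rep \<rho> U \<in> carrier_mat n n" unfolding conj using F(1) F'(1) C by simp
  have "F \<in> Mor ?C (conjugate_rep \<rho> U)"
  proof (rule MorI[OF F(1) C V])
    have "conjugate_rep \<rho> U * amplify F = amplify F * ?C * (amplify (inv_mat F) * amplify F)"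
      unfolding conj using F(1) F'(1) C by (simp add: assoc_mult_mat[of _ n n _ n _ n] mult_carrier_mat[of _ n n _ n])
    then show "amplify F * ?C = conjugate_rep \<rho> U * amplify F"
      unfolding amplify_inverse[OF F] using F(1) C by simp
  qed
  then have F'_Mor: "inv_mat F \<in> Mor (conjugate_rep \<rho> U) ?C" by (rule Mor_inv[OF _ F(2) C V])
  obtain T where T: "T \<in> Mor U (conjugate_rep \<rho> U)" "invertible_mat T"
    using self_conjugate by (auto simp: equivalent_def)
  define W where "W = inv_mat F * T"
  have W: "W \<in> Mor U ?C" unfolding W_def by (rule Mor_mult[OF F'_Mor T(1) U_carrier V C])
  have W_inv: "invertible_mat W"
    unfolding W_def
    by (rule invertible_mat_mult[OF F'(1) invertible_inv_mat[OF F] MorD(1)[OF T(1) U_carrier V] T(2)])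
  have Wc: "W \<in> carrier_mat n n" by (rule MorD(1)[OF W U_carrier C])
  note W' = inv_mat_properties[OF Wc W_inv]
  interpret unitary_with_modulus n U \<rho>
    using U_carrier star Mor_invertible[OF W W_inv U_carrier Uinv C] rho by unfold_locales
  have Q: "inv_mat (transpose_mat \<rho>) = transpose_mat (inv_mat \<rho>)"
    by (rule invertible_mat_transpose(2)[OF r(1,3)])
  have "\<rho> = inv_mat W * transpose_mat (inv_mat \<rho>) * W"
    using rho_eq_if_equivalent_contragredient[OF W W_inv] by (simp only: Q)
  then have "similar_mat_wit \<rho> (transpose_mat (inv_mat \<rho>)) (inv_mat W) W"
    by (rule similar_mat_witI[OF W'(3,2)]) (use r(1) rho_inv(1) Wc W'(1) in auto)
  then have "char_poly \<rho> = char_poly (transpose_mat (inv_mat \<rho>))"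
    by (intro char_poly_similar) (auto simp: similar_mat_def)
  also have "\<dots> = char_poly (inv_mat \<rho>)" by (rule char_poly_transpose_mat[OF rho_inv(1)])
  finally show ?thesis by (simp add: eigenvalues_desc_def)
qed

end
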